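(* Let $(\Sigma,\mathcal T)$ be an ideally triangulated surface with boundary, and let $d=d(f)$ be a discrete conformal structure on $(\Sigma,\mathcal T)$. (i) For any right-angled hyperbolic hexagon $\{ijk\}\in F$, $$\frac{\partial\theta_i^{jk}}{\partial f_j}=\frac{-1}{\sinh d_{ji}}\,\frac{\tanh^{\beta}h_{ij}}{\sinh l_{ij}},$$ where $\beta=1$ if the face center $c_{ijk}$ is time-like and $\beta=-1$ if $c_{ijk}$ is space-like; if $c_{ijk}$ is light-like, the formula is interpreted with $\tanh^\beta h_{ij}=\tanh^\beta h_{jk}=\tanh^\beta h_{ki}=1$. Here $h_{ij}$ is the signed distance from $c_{ijk}$ to the geodesic line $E_{ij}$. (ii) For any right-angled hyperbolic hexagon $\{ijk\}\in F$, $$\frac{\partial\theta_i^{jk}}{\partial f_i}=\cosh l_{ij}\frac{\partial\theta_j^{ik}}{\partial f_i}+\cosh l_{ik}\frac{\partial\theta_k^{ij}}{\partial f_i}.$$ (iii) There exists a change of variables $u_i=u_i(f_i)$, $i\in B$, such that $$\frac{\partial\theta_i^{jk}}{\partial u_j}=\frac{\partial\theta_j^{ik}}{\partial u_i}$$ for every hexagon $\{ijk\}\in F$.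
   Context: Surface. Take a triangulation of a closed surface with $N$ vertices and remove small disjoint open disk neighbourhoods of the vertices; this gives a compact surface $\Sigma$ with boundary components indexed by $B=\{1,\dots,N\}$ and an ideal triangulation $\mathcal T$ with ideal edges $\{ij\}\in E$ joining boundary components $i,j$, oriented edges $(i,j)\in E_+$, and ideal faces $\{ijk\}\in F$, which are hexagons. Given $l\in\mathbb R^E_{>0}$, each face $\{ijk\}$ is the unique right-angled hyperbolic hexagon with three pairwise non-adjacent sides of lengths $l_{ij},l_{jk},l_{ki}$; $\theta_i^{jk}>0$ is the length of the side at $i$: $\cosh\theta_i^{jk}=\frac{\cosh l_{jk}+\cosh l_{ij}\cosh l_{ik}}{\sinh l_{ij}\sinh l_{ik}}$. Discrete conformal structure. A smooth map $f\mapsto d(f)\in\mathbb R^{E_+}$ on an (open) admissible set of $f\in\mathbb R^N$ with $l_{ij}:=d_{ij}+d_{ji}>0$ for every edge; $\sinh d_{ij}\sinh d_{jk}\sinh d_{ki}=\sinh d_{ji}\sinh d_{kj}\sinh d_{ik}$ for every face; $\partial l_{ij}/\partial f_i=\coth d_{ij}$; and $\partial d_{ij}/\partial f_k=0$ if $k\neq i,j$. By the known classification (with the normalization adopted throughout), there are constants $\alpha\in\mathbb R^N$ such that either for all edges $\frac{\sinh d_{ij}}{\sinh d_{ji}}=\pm\sqrt{\frac{1+\alpha_ie^{2f_i}}{1+\alpha_je^{2f_j}}}$ with all $1+\alpha_ie^{2f_i}>0$ (then one may take $\alpha_i\in\{-1,0,1\}$), or for all edges this holds with all $1+\alpha_ie^{2f_i}<0$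 (then $\alpha\equiv-1$), or for all edges $\frac{\sinh d_{ij}}{\sinh d_{ji}}=\pm e^{f_i-f_j}$. The signs of the $d_{ij}$ are fixed, and each face either has all its six $d$'s positive, or has one component $i$ with $d_{ij},d_{ik}<0$ and the other four positive. Geometry. On $\mathbb R^3$ let $x*y=x_1y_1+x_2y_2-x_3y_3$; $x$ is space-like, light-like, time-like if $x*x>0$, $=0$, $<0$. $\mathbb H^2=\{x*x=-1,x_3>0\}$; for space-like $x$, $x^\perp\cap\mathbb H^2$ is a geodesic. In the Klein model (projection to $x_3=1$) time-, light-, space-like vectors are points inside, on, outside the unit circle. Realize the hexagon $\{ijk\}$ in $\mathbb H^2$: there are unit space-like vectors $v_i,v_j,v_k$ such that the boundary arc at $r$ lies on the geodesic $v_r^\perp\cap\mathbb H^2$ and the hexagon lies on the side $v_r*x\le0$; the edge $\{rs\}$ lies on $E_{rs}=\mathrm{Span}(v_r,v_s)\cap\mathbb H^2$. The edge center $c_{rs}\in E_{rs}$ is the point with signed distances $d_{rs}$ to $v_r^\perp$ and $d_{sr}$ to $v_s^\perp$, i.e. $v_r*c_{rs}=-\sinh d_{rs}$, $v_s*c_{rs}=-\sinh d_{sr}$. Let $P_{rs}$ be the geodesic through $c_{rs}$ orthogonal to $E_{rs}$ and $\widetilde P_{rs}$ the 2-plane through the origin with $\widetilde P_{rs}\cap\mathbb H^2=P_{rs}$. The product condition on the $\sinh d$'s is equivalent to the three planes $\widetilde P_{ij},\widetilde P_{jk},\widetilde P_{ki}$ having a common line; the corresponding point in the Klein plane (possibly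 outside the disk) is the face center $c_{ijk}$. Standing assumption: for every $r\in\{i,j,k\}$, $\mathrm{Span}(v_r,c_{ijk})\cap v_r^\perp\cap\mathbb H^2\ne\emptyset$. Signed distance $h_{rs}$. $|h_{rs}|$ is the hyperbolic distance between $c_{ijk}$ and $E_{rs}$ when $c_{ijk}$ is time-like, and the distance between the geodesics $c_{ijk}^\perp\cap\mathbb H^2$ and $E_{rs}$ when $c_{ijk}$ is space-like; $h_{rs}$ is positive if $c_{ijk}$ lies on the same side of $E_{rs}$ as the hexagon (in the Klein model), negative if on the other side, and zero if $c_{ijk}$ lies on $E_{rs}$.
   Formalization: For light-like c_ijk, tanh^β h_ij is taken as 1 only if c_ijk lies on the hexagon's side of E_ij and as -1 on the other side (the stated value 1 gives the wrong sign there); in (i) the hexagon is realized with the centre of the Klein disk inside it, so the side is well defined. *)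

theory Defs
  imports "HOL-Analysis.Analysis"
begin

subsection \<open>Calculus on coordinate space\<close>

definition has_partial :: "(real^'b::finite \<Rightarrow> real) \<Rightarrow> 'b \<Rightarrow> real \<Rightarrow> real^'b \<Rightarrow> bool" where
  "has_partial g j D x \<longleftrightarrow>
     ((\<lambda>t. g (x + t *\<^sub>R axis j 1)) has_real_derivative D) (at 0)"

primrec C_on :: "nat \<Rightarrow> ('a::euclidean_space \<Rightarrow> real) \<Rightarrow> 'a set \<Rightarrow> bool" where
  "C_on 0 g S \<longleftrightarrow> continuous_on S g"
| "C_on (Suc k) g S \<longleftrightarrow> (\<forall>x\<in>S. g differentiable (at x)) \<and>
     (\<forall>b\<in>Basis. C_on k (\<lambda>x. frechet_derivative g (at x) b) S)"

text \<open>Used on open sets only.\<close>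
definition smooth_on :: "('a::euclidean_space) set \<Rightarrow> ('a \<Rightarrow> real) \<Rightarrow> bool" where
  "smooth_on S g \<longleftrightarrow> (\<forall>k. C_on k g S)"

definition coth :: "real \<Rightarrow> real" where
  "coth x = cosh x / sinh x"


subsection \<open>Ideally triangulated surfaces with boundary\<close>

text \<open>The triangulation is a simplicial complex with vertex set \<open>'b\<close>, given by the vertex sets
  of its triangles; after removing disks around the vertices, \<open>'b\<close> indexes the boundary
  components and the triangles become the ideal faces.\<close>

definition oriented_edges :: "'b set set \<Rightarrow> ('b \<times> 'b) set" where
  "oriented_edges F = {(i, j). i \<noteq> j \<and> (\<exists>T\<in>F. i \<in> T \<and> j \<in> T)}"

definition link_edges :: "'b set set \<Rightarrow> 'b \<Rightarrow> ('b \<times> 'b) set" where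
  "link_edges F i = {(a, b). a \<noteq> b \<and> i \<noteq> a \<and> i \<noteq> b \<and> {i, a, b} \<in> F}"

text \<open>Every edge lies in exactly two triangles, so all vertices of a link have degree two; together
  with connectedness this says that the link of each vertex is a cycle, i.e. that the complex is
  a closed surface. The surface itself need not be connected.\<close>
definition closed_surface_triangulation :: "('b::finite) set set \<Rightarrow> bool" where
  "closed_surface_triangulation F \<longleftrightarrow>
     (\<forall>T\<in>F. card T = 3) \<and> \<Union>F = UNIV \<and>
     (\<forall>(i, j)\<in>oriented_edges F. card {T\<in>F. i \<in> T \<and> j \<in> T} = 2) \<and>
     (\<forall>i a b. (i, a) \<in> oriented_edges F \<longrightarrow> (i, b) \<in> oriented_edges F \<longrightarrow>
        (a, b) \<in> (link_edges F i)\<^sup>*)"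


subsection \<open>Discrete conformal structures\<close>

definition edge_length :: "('b \<Rightarrow> 'b \<Rightarrow> real) \<Rightarrow> 'b \<Rightarrow> 'b \<Rightarrow> real" where
  "edge_length \<delta> i j = \<delta> i j + \<delta> j i"

text \<open>\<open>arc_length l i j k\<close> is the length \<open>\<theta>\<^sub>i\<^sup>j\<^sup>k\<close> of the boundary arc at \<open>i\<close>.\<close>
definition arc_length :: "('b \<Rightarrow> 'b \<Rightarrow> real) \<Rightarrow> 'b \<Rightarrow> 'b \<Rightarrow> 'b \<Rightarrow> real" where
  "arc_length l i j k =
     arcosh ((cosh (l j k) + cosh (l i j) * cosh (l i k)) / (sinh (l i j) * sinh (l i k)))"

text \<open>\<open>d f i j\<close> is meaningful for oriented edges \<open>(i, j)\<close> only; \<open>\<Omega>\<close> is the admissible set.\<close>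
definition discrete_conformal_structure ::
  "('b::finite) set set \<Rightarrow> (real^'b) set \<Rightarrow> (real^'b \<Rightarrow> 'b \<Rightarrow> 'b \<Rightarrow> real) \<Rightarrow> bool" where
  "discrete_conformal_structure F \<Omega> d \<longleftrightarrow>
     open \<Omega> \<and>
     (\<forall>(i, j)\<in>oriented_edges F. smooth_on \<Omega> (\<lambda>f. d f i j)) \<and>
     (\<forall>f\<in>\<Omega>. \<forall>(i, j)\<in>oriented_edges F. 0 < edge_length (d f) i j) \<and>
     (\<forall>f\<in>\<Omega>. \<forall>i j k. {i, j, k} \<in> F \<longrightarrow>
        sinh (d f i j) * sinh (d f j k) * sinh (d f k i) =
        sinh (d f j i) * sinh (d f k j) * sinh (d f i k)) \<and>
     (\<forall>f\<in>\<Omega>. \<forall>(i, j)\<in>oriented_edges F.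
        has_partial (\<lambda>g. edge_length (d g) i j) i (coth (d f i j)) f) \<and>
     (\<forall>f\<in>\<Omega>. \<forall>(i, j)\<in>oriented_edges F. \<forall>k. k \<noteq> i \<longrightarrow> k \<noteq> j \<longrightarrow>
        has_partial (\<lambda>g. d g i j) k 0 f)"

text \<open>The normal form provided by the classification of discrete conformal structures.\<close>
definition normal_form ::
  "('b::finite) set set \<Rightarrow> (real^'b) set \<Rightarrow> (real^'b \<Rightarrow> 'b \<Rightarrow> 'b \<Rightarrow> real) \<Rightarrow> bool" where
  "normal_form F \<Omega> d \<longleftrightarrow> (\<exists>\<alpha> :: real^'b.
     let G = (\<lambda>f i. 1 + \<alpha> $ i * exp (2 * f $ i));
         ratio = (\<lambda>\<rho>. \<forall>f\<in>\<Omega>. \<forall>(i, j)\<in>oriented_edges F.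
           sinh (d f i j) / sinh (d f j i) = \<rho> f i j \<or>
           sinh (d f i j) / sinh (d f j i) = - \<rho> f i j)
     in ((\<forall>f\<in>\<Omega>. \<forall>i. G f i > 0) \<and> ratio (\<lambda>f i j. sqrt (G f i / G f j))) \<or>
        ((\<forall>i. \<alpha> $ i = -1) \<and> (\<forall>f\<in>\<Omega>. \<forall>i. G f i < 0) \<and>
           ratio (\<lambda>f i j. sqrt (G f i / G f j))) \<or>
        ratio (\<lambda>f i j. exp (f $ i - f $ j)))"

definition sign_condition ::
  "('b::finite) set set \<Rightarrow> (real^'b) set \<Rightarrow> (real^'b \<Rightarrow> 'b \<Rightarrow> 'b \<Rightarrow> real) \<Rightarrow> bool" where
  "sign_condition F \<Omega> d \<longleftrightarrow>
     (\<forall>f\<in>\<Omega>. \<forall>g\<in>\<Omega>. \<forall>(i, j)\<in>oriented_edges F. sgn (d f i j) = sgn (d g i j)) \<and>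
     (\<forall>f\<in>\<Omega>. \<forall>T\<in>F.
        (\<forall>r\<in>T. \<forall>s\<in>T - {r}. d f r s > 0) \<or>
        (\<exists>i\<in>T. \<forall>s\<in>T - {i}. d f i s < 0 \<and> (\<forall>t\<in>T - {s}. d f s t > 0)))"


subsection \<open>Hyperboloid and Klein model\<close>

definition mink :: "real^3 \<Rightarrow> real^3 \<Rightarrow> real" where
  "mink x y = x$1 * y$1 + x$2 * y$2 - x$3 * y$3"

abbreviation space_like :: "real^3 \<Rightarrow> bool" where "space_like x \<equiv> mink x x > 0"
abbreviation time_like :: "real^3 \<Rightarrow> bool" where "time_like x \<equiv> mink x x < 0"

definition H2 :: "(real^3) set" where
  "H2 = {x. mink x x = -1 \<and> x$3 > 0}"

definition perp :: "real^3 \<Rightarrow> (real^3) set" where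
  "perp v = {x. mink v x = 0}"

definition hdist :: "real^3 \<Rightarrow> real^3 \<Rightarrow> real" where
  "hdist x y = arcosh (- mink x y)"

definition hsetdist :: "(real^3) set \<Rightarrow> (real^3) set \<Rightarrow> real" where
  "hsetdist A B = Inf {hdist x y |x y. x \<in> A \<and> y \<in> B}"


subsection \<open>Realization of a face\<close>

text \<open>\<open>p r s\<close> is the vertex of the hexagon where the edge \<open>{r, s}\<close> meets the boundary arc at \<open>r\<close>.
  The hexagon is the geodesic convex hull in the hyperbolic plane of its six vertices.\<close>
definition hexagon :: "'b set \<Rightarrow> ('b \<Rightarrow> 'b \<Rightarrow> real^3) \<Rightarrow> (real^3) set" where
  "hexagon T p = {x \<in> H2. \<exists>t>0. t *\<^sub>R x \<in> convex hull {p r s |r s. r \<in> T \<and> s \<in> T \<and> r \<noteq> s}}"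

definition edge_line :: "('b \<Rightarrow> real^3) \<Rightarrow> 'b \<Rightarrow> 'b \<Rightarrow> (real^3) set" where
  "edge_line v r s = span {v r, v s} \<inter> H2"

text \<open>The edge \<open>{r, s}\<close> runs on \<open>edge_line v r s\<close> from \<open>p r s\<close> to \<open>p s r\<close>. The right angles are
  automatic, since a plane containing \<open>v r\<close> is orthogonal to \<open>perp (v r)\<close>.\<close>
definition hexagon_realization ::
  "'b set \<Rightarrow> ('b \<Rightarrow> 'b \<Rightarrow> real) \<Rightarrow> ('b \<Rightarrow> real^3) \<Rightarrow> ('b \<Rightarrow> 'b \<Rightarrow> real^3) \<Rightarrow> bool" where
  "hexagon_realization T l v p \<longleftrightarrow>
     (\<forall>r\<in>T. mink (v r) (v r) = 1) \<and>
     (\<forall>r\<in>T. \<forall>s\<in>T - {r}.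
        p r s \<in> edge_line v r s \<inter> perp (v r) \<and> hdist (p r s) (p s r) = l r s) \<and>
     (\<forall>r\<in>T. \<forall>x\<in>hexagon T p. mink (v r) x \<le> 0)"

definition is_edge_center ::
  "('b \<Rightarrow> real^3) \<Rightarrow> ('b \<Rightarrow> 'b \<Rightarrow> real) \<Rightarrow> 'b \<Rightarrow> 'b \<Rightarrow> real^3 \<Rightarrow> bool" where
  "is_edge_center v \<delta> r s e \<longleftrightarrow> e \<in> edge_line v r s \<and>
     mink (v r) e = - sinh (\<delta> r s) \<and> mink (v s) e = - sinh (\<delta> s r)"

text \<open>The plane through the origin that cuts out the geodesic through \<open>e\<close> orthogonal to
  \<open>edge_line v r s\<close>: its direction at \<open>e\<close> is the normal vector of \<open>span {v r, v s}\<close>.\<close>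
definition perp_plane :: "('b \<Rightarrow> real^3) \<Rightarrow> 'b \<Rightarrow> 'b \<Rightarrow> real^3 \<Rightarrow> (real^3) set" where
  "perp_plane v r s e = span (insert e (perp (v r) \<inter> perp (v s)))"

text \<open>The face center as a point of the Klein plane \<open>x$3 = 1\<close>.\<close>
definition is_face_center ::
  "'b set \<Rightarrow> ('b \<Rightarrow> 'b \<Rightarrow> real) \<Rightarrow> ('b \<Rightarrow> real^3) \<Rightarrow> real^3 \<Rightarrow> bool" where
  "is_face_center T \<delta> v c \<longleftrightarrow> c$3 = 1 \<and>
     (\<forall>r\<in>T. \<forall>s\<in>T - {r}. \<exists>e. is_edge_center v \<delta> r s e \<and> c \<in> perp_plane v r s e)"

text \<open>\<open>1\<close> if the Klein point \<open>c\<close> lies on the same side of the edge line \<open>{r, s}\<close> as the hexagon, \<open>-1\<close>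
  if it lies on the other side, \<open>0\<close> if it lies on the line. For space-like \<open>c\<close> this refers to the
  affine chart \<open>x$3 = 1\<close> and is independent of the realization as long as the center \<open>(0, 0, 1)\<close>
  of the Klein disk lies in the hexagon; an isometry taking it far away can move \<open>c\<close> through
  infinity and thereby exchange the sides.\<close>
definition klein_side ::
  "'b set \<Rightarrow> ('b \<Rightarrow> real^3) \<Rightarrow> ('b \<Rightarrow> 'b \<Rightarrow> real^3) \<Rightarrow> 'b \<Rightarrow> 'b \<Rightarrow> real^3 \<Rightarrow> real" where
  "klein_side T v p r s c =
     (if c \<in> span {v r, v s} then 0
      else if \<exists>n \<in> perp (v r) \<inter> perp (v s). (\<forall>x\<in>hexagon T p. mink n x \<ge> 0) \<and> mink n c > 0
      then 1 else -1)"

definition signed_dist ::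
  "'b set \<Rightarrow> ('b \<Rightarrow> real^3) \<Rightarrow> ('b \<Rightarrow> 'b \<Rightarrow> real^3) \<Rightarrow> 'b \<Rightarrow> 'b \<Rightarrow> real^3 \<Rightarrow> real" where
  "signed_dist T v p r s c = klein_side T v p r s c *
     (if time_like c then hsetdist {(1 / sqrt (- mink c c)) *\<^sub>R c} (edge_line v r s)
      else hsetdist (perp c \<inter> H2) (edge_line v r s))"

text \<open>\<open>tanh\<^sup>\<beta> h\<close> with \<open>\<beta> = 1\<close> for time-like and \<open>\<beta> = -1\<close> for space-like \<open>c\<close>. If \<open>c\<close> is light-like,
  the distance is infinite and \<open>tanh\<^sup>\<beta> h\<close> stands for the limit: \<open>1\<close> if \<open>c\<close> lies on the same side of
  the edge line as the hexagon. The sign rule of the signed distance is kept here, i.e. the value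
  is \<open>-1\<close> when \<open>c\<close> lies on the other side.\<close>
definition tanh_pow ::
  "'b set \<Rightarrow> ('b \<Rightarrow> real^3) \<Rightarrow> ('b \<Rightarrow> 'b \<Rightarrow> real^3) \<Rightarrow> 'b \<Rightarrow> 'b \<Rightarrow> real^3 \<Rightarrow> real" where
  "tanh_pow T v p r s c =
     (if time_like c then tanh (signed_dist T v p r s c) powi 1
      else if space_like c then tanh (signed_dist T v p r s c) powi (-1)
      else klein_side T v p r s c)"


subsection \<open>Change of variables\<close>

text \<open>\<open>u i\<close> is a diffeomorphism from the set of values of \<open>f $ i\<close> on \<open>\<Omega>\<close> onto its image.\<close>
definition change_of_variables :: "(real^'b::finite) set \<Rightarrow> ('b \<Rightarrow> real \<Rightarrow> real) \<Rightarrow> bool" where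
  "change_of_variables \<Omega> u \<longleftrightarrow> (\<forall>i.
     inj_on (u i) ((\<lambda>f. f $ i) ` \<Omega>) \<and>
     smooth_on ((\<lambda>f. f $ i) ` \<Omega>) (u i) \<and>
     (\<forall>x\<in>(\<lambda>f. f $ i) ` \<Omega>. deriv (u i) x \<noteq> 0))"

definition coord_map :: "('b \<Rightarrow> real \<Rightarrow> real) \<Rightarrow> real^'b::finite \<Rightarrow> real^'b" where
  "coord_map u f = (\<chi> i. u i (f $ i))"

end

theory Submission
  imports Defs
begin

text \<open>The right-angled hexagon cosine law gives the derivatives of \<open>\<theta>\<^sub>i\<^sup>j\<^sup>k\<close> in terms of the lengths, and
  \<open>\<partial>l\<^sub>i\<^sub>j / \<partial>f\<^sub>i = coth d\<^sub>i\<^sub>j\<close> turns them into derivatives in terms of \<open>f\<close>; part (ii) is then an identity.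
  For part (i), write the face center as \<open>c = A e + B n\<close> with the edge center \<open>e\<close> of \<open>{i, j}\<close> and the
  unit normal \<open>n\<close> of its edge line. Then \<open>tanh\<^sup>\<beta> h\<^sub>i\<^sub>j = B / A\<close> in all three cases, provided that \<open>A > 0\<close>,
  and \<open>B\<close> is computed by expanding \<open>n\<close> in \<open>v\<^sub>i, v\<^sub>j, v\<^sub>k\<close>. By the product condition,
  \<open>sinh d\<^sub>j\<^sub>i \<partial>\<theta>\<^sub>i / \<partial>f\<^sub>j\<close> is symmetric in \<open>i\<close> and \<open>j\<close>, so part (iii) asks for functions \<open>u\<^sub>i\<close> with
  \<open>u\<^sub>j' / u\<^sub>i' = sinh d\<^sub>i\<^sub>j / sinh d\<^sub>j\<^sub>i\<close>. The normal form provides them up to a sign at each vertex. This sign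
  is well defined, since \<open>sgn d\<^sub>i\<^sub>j\<close> is constant along the link of \<open>i\<close>, which is connected.\<close>

section \<open>The cosine law\<close>

lemma cosh_gt_1: "cosh x > 1" if "x > 0" for x :: real
  using that cosh_real_strict_mono[of 0 x] by simp

text \<open>In a hexagon with edge lengths \<open>a, b, c\<close> this is \<open>sinh \<theta> sinh b sinh c\<close>, where \<open>\<theta>\<close> is the boundary arc
  opposite to \<open>a\<close>.\<close>

definition hex_root :: "real \<Rightarrow> real \<Rightarrow> real \<Rightarrow> real" where
  "hex_root a b c = sqrt ((cosh a)\<^sup>2 + (cosh b)\<^sup>2 + (cosh c)\<^sup>2 + 2 * cosh a * cosh b * cosh c - 1)"

lemma hex_root_commute: "hex_root a b c = hex_root b a c" "hex_root a b c = hex_root a c b"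
  by (simp_all add: hex_root_def algebra_simps)

lemma hex_root_square_pos:
  fixes a b c :: real
  shows "0 < (cosh a)\<^sup>2 + (cosh b)\<^sup>2 + (cosh c)\<^sup>2 + 2 * cosh a * cosh b * cosh c - 1"
proof -
  have "1 \<le> (cosh a)\<^sup>2" by (simp add: cosh_real_ge_1)
  moreover have "0 < 2 * cosh a * cosh b * cosh c" by simp
  moreover have "0 \<le> (cosh b)\<^sup>2" "0 \<le> (cosh c)\<^sup>2" by simp_all
  ultimately show ?thesis by linarith
qed

lemma hex_root_square:
  "(hex_root a b c)\<^sup>2 = (cosh a)\<^sup>2 + (cosh b)\<^sup>2 + (cosh c)\<^sup>2 + 2 * cosh a * cosh b * cosh c - 1"
  unfolding hex_root_def using hex_root_square_pos[of a b c] by simp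

lemma hex_root_pos: "hex_root a b c > 0"
  unfolding hex_root_def using hex_root_square_pos[of a b c] by simp

text \<open>Chain rule for \<open>arcosh\<close>: the square root it produces is
  \<open>hex_root\<close> over the two hyperbolic sines, which then cancel. By the cosine law, the
  factors of \<open>b'\<close> and \<open>c'\<close> are, up to sign, \<open>sinh (a x)\<close>
  times the hyperbolic cosines of the arcs opposite to \<open>c\<close> and \<open>b\<close>. All
  three lengths vary at once, so that one statement serves every partial derivative.\<close>

lemma has_real_derivative_hexagon_arc:
  fixes a b c :: "real \<Rightarrow> real"
  assumes [derivative_intros]: "(a has_real_derivative a') (at x)"
      "(b has_real_derivative b') (at x)" "(c has_real_derivative c') (at x)"
    and pos: "0 < a x" "0 < b x" "0 < c x"
  shows "((\<lambda>t. arcosh ((cosh (a t) + cosh (b t) * cosh (c t)) / (sinh (b t) * sinh (c t))))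
    has_real_derivative
      (sinh (a x) * a'
        - (cosh (c x) + cosh (a x) * cosh (b x)) / sinh (b x) * b'
        - (cosh (b x) + cosh (a x) * cosh (c x)) / sinh (c x) * c') / hex_root (a x) (b x) (c x)) (at x)"
proof -
  define ca cb cc sb sc where defs: "ca = cosh (a x)" "cb = cosh (b x)" "cc = cosh (c x)"
    "sb = sinh (b x)" "sc = sinh (c x)"
  define X where "X = (ca + cb * cc) / (sb * sc)"
  have s: "sb > 0" "sc > 0" and c1: "ca > 1" "cb > 1" "cc > 1"
    using pos by (simp_all add: defs cosh_gt_1)
  have sq: "sb\<^sup>2 = cb\<^sup>2 - 1" "sc\<^sup>2 = cc\<^sup>2 - 1" by (simp_all add: defs sinh_square_eq)
  \<comment> \<open>The derivative formula for \<open>arcosh\<close> needs an argument beyond 1.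
    This holds because the product of the sines stays below the product of the cosines.\<close>
  have "sb < cb" "sc < cc"
    unfolding defs by (simp_all add: sinh_def cosh_def field_simps)
  then have "sb * sc < cb * cc" using s by (intro mult_strict_mono) auto
  then have X1: "X > 1" using s c1 by (simp add: X_def)
  have "X\<^sup>2 - 1 = ((ca + cb * cc)\<^sup>2 - sb\<^sup>2 * sc\<^sup>2) / (sb * sc)\<^sup>2"
    using s by (simp add: X_def field_simps)
  also have "(ca + cb * cc)\<^sup>2 - sb\<^sup>2 * sc\<^sup>2 = (hex_root (a x) (b x) (c x))\<^sup>2"
    unfolding sq hex_root_square unfolding defs by (simp add: power2_eq_square algebra_simps)
  finally have root: "sqrt (X\<^sup>2 - 1) = hex_root (a x) (b x) (c x) / (sb * sc)"
    using s hex_root_pos[of "a x" "b x" "c x"]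
    by (simp add: real_sqrt_divide real_sqrt_mult)
  have "((\<lambda>t. (cosh (a t) + cosh (b t) * cosh (c t)) / (sinh (b t) * sinh (c t)))
    has_real_derivative
      (((sinh (a x) * a') + (sb * b' * cc + cb * (sc * c'))) * (sb * sc)
        - (ca + cb * cc) * (cb * b' * sc + sb * (cc * c'))) / ((sb * sc) * (sb * sc))) (at x)"
    using s unfolding defs by (auto intro!: derivative_eq_intros simp: algebra_simps)
  also have "((sinh (a x) * a') + (sb * b' * cc + cb * (sc * c'))) * (sb * sc)
        - (ca + cb * cc) * (cb * b' * sc + sb * (cc * c'))
      = sinh (a x) * a' * (sb * sc) + sb\<^sup>2 * (cc * sc * b') + sc\<^sup>2 * (cb * sb * c')
        - (ca + cb * cc) * (cb * b' * sc + sb * (cc * c'))"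
    by (simp add: power2_eq_square algebra_simps)
  \<comment> \<open>Replacing squared sines by squared cosines minus 1 cancels the cubic terms and
    leaves the numerators of the cosine law for the other two arcs.\<close>
  also have "\<dots> = sinh (a x) * a' * (sb * sc) - (cc + ca * cb) * b' * sc - (cb + ca * cc) * c' * sb"
    unfolding sq by (simp add: power2_eq_square algebra_simps)
  finally have D: "((\<lambda>t. (cosh (a t) + cosh (b t) * cosh (c t)) / (sinh (b t) * sinh (c t)))
    has_real_derivative
      (sinh (a x) * a' * (sb * sc) - (cc + ca * cb) * b' * sc - (cb + ca * cc) * c' * sb)
        / ((sb * sc) * (sb * sc))) (at x)" .
  have "(arcosh has_real_derivative 1 / sqrt (X\<^sup>2 - 1)) (at X)"
    using X1 by (rule arcosh_real_has_field_derivative)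
  then have "(arcosh has_real_derivative 1 / sqrt (X\<^sup>2 - 1))
    (at ((cosh (a x) + cosh (b x) * cosh (c x)) / (sinh (b x) * sinh (c x))))"
    by (simp add: X_def defs)
  from DERIV_chain2[OF this D] show ?thesis
  proof (rule DERIV_cong)
    have "1 / (R / (sb * sc)) * ((p * (sb * sc) - q * b' * sc - r * c' * sb) / ((sb * sc) * (sb * sc)))
        = (p - q / sb * b' - r / sc * c') / R" if "R > 0" for p q r R
      using s that by (simp add: field_simps)
    from this[OF hex_root_pos]
    show "1 / sqrt (X\<^sup>2 - 1) *
      ((sinh (a x) * a' * (sb * sc) - (cc + ca * cb) * b' * sc - (cb + ca * cc) * c' * sb)
        / ((sb * sc) * (sb * sc))) =
      (sinh (a x) * a' - (cosh (c x) + cosh (a x) * cosh (b x)) / sinh (b x) * b'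
        - (cosh (b x) + cosh (a x) * cosh (c x)) / sinh (c x) * c') / hex_root (a x) (b x) (c x)"
      unfolding root by (simp only: defs)
  qed
qed

section \<open>Smooth functions of one real variable\<close>

text \<open>On an open set equal functions have equal derivatives, since a derivative only sees a
  neighbourhood; the induction then passes to the derivatives.\<close>

lemma C_on_cong:
  assumes "open S" "\<And>x. x \<in> S \<Longrightarrow> g x = h x" "C_on k g S"
  shows "C_on k h S"
  using assms(2,3)
proof (induction k arbitrary: g h)
  case 0
  then show ?case by (metis C_on.simps(1) continuous_on_cong)
next
  case (Suc k)
  have der: "(h has_derivative frechet_derivative g (at x)) (at x)" if "x \<in> S" for x
    using Suc.prems that \<open>open S\<close>
    by (intro has_derivative_transform_within_open[of g _ x UNIV S h])
      (auto simp: frechet_derivative_works[symmetric])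
  have eq: "frechet_derivative g (at x) = frechet_derivative h (at x)" if "x \<in> S" for x
    using frechet_derivative_at[OF der[OF that]] .
  show ?case
    unfolding C_on.simps
  proof (intro conjI ballI)
    show "h differentiable (at x)" if "x \<in> S" for x
      using der[OF that] by (auto simp: differentiable_def)
    show "C_on k (\<lambda>x. frechet_derivative h (at x) b) S" if "b \<in> Basis" for b
    proof (rule Suc.IH)
      show "frechet_derivative g (at x) b = frechet_derivative h (at x) b" if "x \<in> S" for x
        using eq[OF that] by simp
      show "C_on k (\<lambda>x. frechet_derivative g (at x) b) S"
        using Suc.prems(2) \<open>b \<in> Basis\<close> by simp
    qed
  qed
qed

text \<open>The basis of the reals is \<open>{1}\<close>, so the recursion of \<open>C_on\<close>
  involves one ordinary derivative. By \<open>C_on_cong\<close> it can be replaced by any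
  \<open>g'\<close> that represents it on \<open>S\<close>.\<close>

lemma C_on_Suc_real:
  fixes g :: "real \<Rightarrow> real"
  assumes "open S" "\<And>x. x \<in> S \<Longrightarrow> (g has_real_derivative g' x) (at x)"
  shows "C_on (Suc k) g S \<longleftrightarrow> C_on k g' S"
proof -
  have eq: "frechet_derivative g (at x) 1 = g' x" if "x \<in> S" for x
    using frechet_derivative_at[OF assms(2)[OF that, unfolded has_field_derivative_def]]
    by (metis mult.right_neutral)
  have "\<forall>x\<in>S. g differentiable (at x)"
    using assms(2) real_differentiable_def by blast
  then have "C_on (Suc k) g S \<longleftrightarrow> C_on k (\<lambda>x. frechet_derivative g (at x) 1) S"
    by simp
  also have "\<dots> \<longleftrightarrow> C_on k g' S"
    using C_on_cong[OF \<open>open S\<close>, of g' "\<lambda>x. frechet_derivative g (at x) 1" k]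
      C_on_cong[OF \<open>open S\<close>, of "\<lambda>x. frechet_derivative g (at x) 1" g' k] eq
    by (intro iffI) simp_all
  finally show ?thesis .
qed

lemma C_on_SucE_real:
  fixes g :: "real \<Rightarrow> real"
  assumes "open S" "C_on (Suc k) g S"
  obtains g' where "\<And>x. x \<in> S \<Longrightarrow> (g has_real_derivative g' x) (at x)" "C_on k g' S"
proof -
  have "\<forall>x\<in>S. (g has_real_derivative deriv g x) (at x)"
    using assms by (simp add: DERIV_deriv_iff_real_differentiable)
  with that[of "deriv g"] C_on_Suc_real[OF assms(1), of g "deriv g" k] assms(2) show ?thesis
    by (simp del: C_on.simps)
qed

text \<open>The recursion records differentiability and the regularity of the derivative only, so
  monotonicity in the order needs an induction that starts from differentiable functions being
  continuous.\<close>

lemma C_on_Suc_imp: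
  fixes g :: "real \<Rightarrow> real"
  assumes "open S" "C_on (Suc k) g S"
  shows "C_on k g S"
  using assms(2)
proof (induction k arbitrary: g)
  case 0
  then show ?case
    by (simp add: continuous_at_imp_continuous_on differentiable_imp_continuous_within)
next
  case (Suc k)
  from C_on_SucE_real[OF \<open>open S\<close> Suc.prems] obtain g' where
    "\<And>x. x \<in> S \<Longrightarrow> (g has_real_derivative g' x) (at x)" "C_on (Suc k) g' S" by blast
  with Suc.IH[of g'] C_on_Suc_real[OF \<open>open S\<close>, of g g' k] show ?case by simp
qed

lemma C_on_add:
  fixes g h :: "real \<Rightarrow> real"
  assumes "open S" "C_on k g S" "C_on k h S"
  shows "C_on k (\<lambda>x. g x + h x) S"
  using assms(2,3)
proof (induction k arbitrary: g h)
  case 0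
  then show ?case by (auto intro: continuous_on_add)
next
  case (Suc k)
  obtain g' h' where
    g': "\<And>x. x \<in> S \<Longrightarrow> (g has_real_derivative g' x) (at x)" "C_on k g' S" and
    h': "\<And>x. x \<in> S \<Longrightarrow> (h has_real_derivative h' x) (at x)" "C_on k h' S"
    using C_on_SucE_real[OF \<open>open S\<close> Suc.prems(1)] C_on_SucE_real[OF \<open>open S\<close> Suc.prems(2)] by metis
  have "((\<lambda>x. g x + h x) has_real_derivative g' x + h' x) (at x)" if "x \<in> S" for x
    using g'(1) h'(1) that by (auto intro!: derivative_eq_intros)
  from C_on_Suc_real[OF \<open>open S\<close> this] Suc.IH[OF g'(2) h'(2)] show ?case by blast
qed

lemma C_on_mult:
  fixes g h :: "real \<Rightarrow> real"
  assumes "open S" "C_on k g S" "C_on k h S"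
  shows "C_on k (\<lambda>x. g x * h x) S"
  using assms(2,3)
proof (induction k arbitrary: g h)
  case 0
  then show ?case by (auto intro: continuous_on_mult)
next
  case (Suc k)
  obtain g' h' where
    g': "\<And>x. x \<in> S \<Longrightarrow> (g has_real_derivative g' x) (at x)" "C_on k g' S" and
    h': "\<And>x. x \<in> S \<Longrightarrow> (h has_real_derivative h' x) (at x)" "C_on k h' S"
    using C_on_SucE_real[OF \<open>open S\<close> Suc.prems(1)] C_on_SucE_real[OF \<open>open S\<close> Suc.prems(2)] by metis
  have der: "((\<lambda>x. g x * h x) has_real_derivative g' x * h x + g x * h' x) (at x)" if "x \<in> S" for x
    using g'(1) h'(1) that by (auto intro!: derivative_eq_intros)
  have "C_on k (\<lambda>x. g' x * h x + g x * h' x) S"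
    using C_on_add[OF \<open>open S\<close> Suc.IH[OF g'(2) C_on_Suc_imp[OF \<open>open S\<close> Suc.prems(2)]]
      Suc.IH[OF C_on_Suc_imp[OF \<open>open S\<close> Suc.prems(1)] h'(2)]] .
  with C_on_Suc_real[OF \<open>open S\<close> der] show ?case by blast
qed

text \<open>The factor \<open>\<kappa>\<close> is arbitrary because each derivative multiplies it by
  \<open>m\<close>. The value \<open>m = 0\<close> covers constants.\<close>

lemma C_on_cmult_exp: "open S \<Longrightarrow> C_on k (\<lambda>x::real. \<kappa> * exp (m * x)) S"
proof (induction k arbitrary: \<kappa>)
  case 0
  then show ?case by (auto intro!: continuous_intros)
next
  case (Suc k)
  have "((\<lambda>x. \<kappa> * exp (m * x)) has_real_derivative (\<kappa> * m) * exp (m * x)) (at x)" for x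
    by (auto intro!: derivative_eq_intros)
  from C_on_Suc_real[OF Suc.prems this] Suc.IH[OF Suc.prems] show ?case by blast
qed

text \<open>Bootstrapping: if \<open>w\<close> has \<open>k\<close> continuous derivatives, so has
  the right-hand side of its differential equation, which is its derivative. No formula for higher
  derivatives is required.\<close>

lemma C_on_cubic_ode:
  fixes w :: "real \<Rightarrow> real"
  assumes "open S"
    and "\<And>x. x \<in> S \<Longrightarrow> (w has_real_derivative \<kappa> * exp (m * x) * (w x * w x * w x)) (at x)"
  shows "C_on k w S"
proof (induction k)
  case 0
  show ?case
    unfolding C_on.simps using assms(2) DERIV_isCont
    by (intro continuous_at_imp_continuous_on ballI) blast
next
  case (Suc k)
  then have "C_on k (\<lambda>x. \<kappa> * exp (m * x) * (w x * w x * w x)) S"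
    using C_on_mult[OF \<open>open S\<close>] C_on_cmult_exp[OF \<open>open S\<close>] by blast
  with C_on_Suc_real[OF assms] show ?case by blast
qed

lemma smooth_on_antiderivative:
  fixes g :: "real \<Rightarrow> real"
  assumes "open S" "\<And>x. x \<in> S \<Longrightarrow> (g has_real_derivative w x) (at x)" "\<And>k. C_on k w S"
  shows "smooth_on S g"
  unfolding smooth_on_def
proof
  fix k
  have "C_on (Suc k) g S" using C_on_Suc_real[OF assms(1,2)] assms(3) by simp
  with assms(1) show "C_on k g S" by (rule C_on_Suc_imp)
qed

section \<open>Separate changes of the coordinates\<close>

lemma open_coord_image:
  assumes "open (\<Omega> :: (real^'b::finite) set)"
  shows "open ((\<lambda>f. f $ i) ` \<Omega>)"
  unfolding open_dist
proof clarify
  fix f assume "f \<in> \<Omega>"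
  with assms obtain e where e: "e > 0" "ball f e \<subseteq> \<Omega>" by (meson open_contains_ball)
  have "y \<in> (\<lambda>f. f $ i) ` \<Omega>" if "dist y (f $ i) < e" for y
  proof -
    have "f + (y - f $ i) *\<^sub>R axis i 1 \<in> ball f e"
      using that by (simp add: dist_norm)
    then show ?thesis using e by (intro image_eqI[of _ _ "f + (y - f $ i) *\<^sub>R axis i 1"]) auto
  qed
  with e show "\<exists>e>0. \<forall>y. dist y (f $ i) < e \<longrightarrow> y \<in> (\<lambda>f. f $ i) ` \<Omega>" by blast
qed

text \<open>The map changes each coordinate separately, so it carries the line through
  \<open>f\<close> in direction \<open>j\<close> into the line through the image point in the same
  direction. The claim thus reduces to the inverse function theorem in one variable and the chain
  rule.\<close>

lemma has_partial_change_of_coordinates: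
  fixes \<Omega> :: "(real^'b::finite) set"
  assumes "open \<Omega>" "f \<in> \<Omega>"
    and inj: "\<And>i. inj_on (u i) ((\<lambda>f. f $ i) ` \<Omega>)"
    and der: "\<And>x. x \<in> (\<lambda>f. f $ j) ` \<Omega> \<Longrightarrow> (u j has_real_derivative w x) (at x)"
    and w: "w (f $ j) \<noteq> 0"
    and D: "has_partial g j D f"
  shows "has_partial (\<lambda>y. g (inv_into \<Omega> (coord_map u) y)) j (D / w (f $ j)) (coord_map u f)"
proof -
  obtain e where e: "e > 0" "ball f e \<subseteq> \<Omega>" using assms(1,2) by (meson open_contains_ball)
  define S where "S = ball (0::real) e"
  \<comment> \<open>Displacement of the new coordinate \<open>j\<close> when the old one moves by
    \<open>s\<close>; \<open>\<phi>\<close> is its local inverse.\<close>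
  define \<psi> where "\<psi> s = u j (f $ j + s) - u j (f $ j)" for s
  define \<phi> where "\<phi> = inv_into S \<psi>"
  have S: "open S" "0 \<in> S" using e by (auto simp: S_def)
  have in\<Omega>: "f + s *\<^sub>R axis j 1 \<in> \<Omega>" if "s \<in> S" for s
    using that e by (auto simp: S_def dist_norm subset_iff)
  have inproj: "f $ j + s \<in> (\<lambda>f. f $ j) ` \<Omega>" if "s \<in> S" for s
    using in\<Omega>[OF that] by (intro image_eqI[of _ _ "f + s *\<^sub>R axis j 1"]) auto
  have inj\<psi>: "inj_on \<psi> S"
  proof (rule inj_onI)
    fix s t assume "s \<in> S" "t \<in> S" "\<psi> s = \<psi> t"
    with inj_onD[OF inj[of j] _ inproj inproj, of s t] show "s = t" by (simp add: \<psi>_def)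
  qed
  have der\<psi>: "(\<psi> has_real_derivative w (f $ j + s)) (at s)" if "s \<in> S" for s
  proof -
    have "((\<lambda>s. u j (f $ j + s)) has_real_derivative w (f $ j + s) * 1) (at s)"
      by (rule DERIV_chain2[where f = "u j" and g = "\<lambda>s. f $ j + s", OF der[OF inproj[OF that]]])
        (auto intro!: derivative_eq_intros)
    then show ?thesis unfolding \<psi>_def by (auto intro!: derivative_eq_intros)
  qed
  have cont: "continuous_on S \<psi>"
    using der\<psi> DERIV_isCont by (intro continuous_at_imp_continuous_on ballI) blast
  have "(\<phi> has_derivative (*) (inverse (w (f $ j)))) (at (\<psi> 0))"
  proof (rule has_derivative_inverse_strong[OF S cont])
    show "\<phi> (\<psi> x) = x" if "x \<in> S" for x using that inj\<psi> by (simp add: \<phi>_def)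
    show "(\<psi> has_derivative (*) (w (f $ j))) (at 0)"
      using der\<psi>[OF S(2)] by (simp add: has_field_derivative_def)
    show "(*) (w (f $ j)) \<circ> (*) (inverse (w (f $ j))) = id"
      using w by (auto simp: fun_eq_iff)
  qed
  moreover have "\<psi> 0 = 0" by (simp add: \<psi>_def)
  ultimately have der\<phi>: "(\<phi> has_real_derivative inverse (w (f $ j))) (at 0)"
    by (simp add: has_field_derivative_def)
  have \<phi>0: "\<phi> 0 = 0" using inj\<psi> S \<open>\<psi> 0 = 0\<close> unfolding \<phi>_def by (metis inv_into_f_f)
  \<comment> \<open>Injectivity in every coordinate makes \<open>inv_into\<close> a genuine inverse
    on the image of \<open>\<Omega>\<close>.\<close>
  have "inj_on (coord_map u) \<Omega>"
  proof (rule inj_onI)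
    fix x y assume "x \<in> \<Omega>" "y \<in> \<Omega>" "coord_map u x = coord_map u y"
    then have "u i (x $ i) = u i (y $ i)" for i by (simp add: coord_map_def vec_eq_iff)
    with \<open>x \<in> \<Omega>\<close> \<open>y \<in> \<Omega>\<close> inj_onD[OF inj] show "x = y" by (auto simp: vec_eq_iff)
  qed
  moreover have "coord_map u (f + s *\<^sub>R axis j 1) = coord_map u f + \<psi> s *\<^sub>R axis j 1" for s
    by (auto simp: coord_map_def \<psi>_def vec_eq_iff axis_def)
  ultimately have inv: "inv_into \<Omega> (coord_map u) (coord_map u f + \<psi> s *\<^sub>R axis j 1) = f + s *\<^sub>R axis j 1"
    if "s \<in> S" for s
    using in\<Omega>[OF that] by (metis inv_into_f_f)
  have "((\<lambda>t. g (f + t *\<^sub>R axis j 1)) has_real_derivative D) (at (\<phi> 0))"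
    using D by (simp add: has_partial_def \<phi>0)
  from DERIV_chain2[OF this der\<phi>]
  have "((\<lambda>t. g (f + \<phi> t *\<^sub>R axis j 1)) has_real_derivative D / w (f $ j)) (at 0)"
    by (simp add: divide_inverse)
  moreover have "open (\<psi> ` S)" using cont S(1) inj\<psi> by (rule invariance_of_domain)
  moreover have "0 \<in> \<psi> ` S" using S(2) \<open>\<psi> 0 = 0\<close> by force
  moreover have "g (f + \<phi> t *\<^sub>R axis j 1)
      = g (inv_into \<Omega> (coord_map u) (coord_map u f + t *\<^sub>R axis j 1))" if "t \<in> \<psi> ` S" for t
    using that inv inj\<psi> by (auto simp: \<phi>_def)
  ultimately show ?thesis
    unfolding has_partial_def by (rule has_field_derivative_transform_within_open)
qed

section \<open>Partial derivatives of the arc lengths\<close>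

lemma face_distinct:
  assumes "closed_surface_triangulation F" "{i, j, k} \<in> F"
  shows "i \<noteq> j" "j \<noteq> k" "i \<noteq> k"
proof -
  have "card {i, j, k} = 3" using assms by (auto simp: closed_surface_triangulation_def)
  then show "i \<noteq> j" "j \<noteq> k" "i \<noteq> k" by (auto simp: card_insert_if split: if_splits)
qed

lemma oriented_edgesI: "T \<in> F \<Longrightarrow> i \<in> T \<Longrightarrow> j \<in> T \<Longrightarrow> i \<noteq> j \<Longrightarrow> (i, j) \<in> oriented_edges F"
  by (auto simp: oriented_edges_def)

lemma edge_length_commute: "edge_length \<delta> i j = edge_length \<delta> j i"
  by (simp add: edge_length_def)

text \<open>Moving \<open>f $ j\<close> changes the two edges at \<open>j\<close> at coth rates and
  fixes \<open>l i k\<close>; moving \<open>f $ i\<close> changes the two edges at \<open>i\<close>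
  and fixes \<open>l j k\<close>. The differentiated cosine law turns these rates into derivatives
  of the arc.\<close>

lemma has_partial_arc_length:
  fixes d :: "real^'b::finite \<Rightarrow> 'b \<Rightarrow> 'b \<Rightarrow> real" and f :: "real^'b"
  defines "l \<equiv> edge_length (d f)"
  assumes dcs: "discrete_conformal_structure F \<Omega> d" and f: "f \<in> \<Omega>"
    and T: "T \<in> F" "i \<in> T" "j \<in> T" "k \<in> T" and ne: "i \<noteq> j" "j \<noteq> k" "i \<noteq> k"
  shows has_partial_arc_length_other:
      "has_partial (\<lambda>g. arc_length (edge_length (d g)) i j k) j
        ((sinh (l j k) * coth (d f j k)
          - (cosh (l i k) + cosh (l j k) * cosh (l i j)) / sinh (l i j) * coth (d f j i))
            / hex_root (l j k) (l i j) (l i k)) f"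
    and has_partial_arc_length_self:
      "has_partial (\<lambda>g. arc_length (edge_length (d g)) i j k) i
        ((- ((cosh (l i k) + cosh (l j k) * cosh (l i j)) / sinh (l i j) * coth (d f i j))
          - (cosh (l i j) + cosh (l j k) * cosh (l i k)) / sinh (l i k) * coth (d f i k))
            / hex_root (l j k) (l i j) (l i k)) f"
proof -
  have l_pos: "0 < l r s" if "(r, s) \<in> oriented_edges F" for r s
    using dcs f that by (auto simp: discrete_conformal_structure_def l_def)
  have E: "(i, j) \<in> oriented_edges F" "(j, i) \<in> oriented_edges F" "(i, k) \<in> oriented_edges F"
    "(k, i) \<in> oriented_edges F" "(j, k) \<in> oriented_edges F" "(k, j) \<in> oriented_edges F"
    using T ne by (auto intro: oriented_edgesI)
  have near: "((\<lambda>t. edge_length (d (f + t *\<^sub>R axis r 1)) r s) has_real_derivative coth (d f r s)) (at 0)"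
    if "(r, s) \<in> oriented_edges F" for r s
    using dcs f that by (force simp: discrete_conformal_structure_def has_partial_def)
  have far: "((\<lambda>t. edge_length (d (f + t *\<^sub>R axis q 1)) r s) has_real_derivative 0) (at 0)"
    if "(r, s) \<in> oriented_edges F" "(s, r) \<in> oriented_edges F" "q \<noteq> r" "q \<noteq> s" for q r s
  proof -
    have "((\<lambda>t. d (f + t *\<^sub>R axis q 1) r s) has_real_derivative 0) (at 0)"
      "((\<lambda>t. d (f + t *\<^sub>R axis q 1) s r) has_real_derivative 0) (at 0)"
      using dcs f that by (force simp: discrete_conformal_structure_def has_partial_def)+
    then show ?thesis
      unfolding edge_length_def by (auto intro!: derivative_eq_intros)
  qed
  have near': "((\<lambda>t. edge_length (d (f + t *\<^sub>R axis j 1)) i j) has_real_derivative coth (d f j i)) (at 0)"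
    using near[OF E(2)] by (simp add: edge_length_commute[of _ j i])
  show "has_partial (\<lambda>g. arc_length (edge_length (d g)) i j k) j
        ((sinh (l j k) * coth (d f j k)
          - (cosh (l i k) + cosh (l j k) * cosh (l i j)) / sinh (l i j) * coth (d f j i))
            / hex_root (l j k) (l i j) (l i k)) f"
    using has_real_derivative_hexagon_arc[OF near[OF E(5)] near' far[OF E(3,4) ne(1)[symmetric] ne(2)]] ne
      l_pos[OF E(5)] l_pos[OF E(1)] l_pos[OF E(3)]
    by (simp add: has_partial_def arc_length_def l_def)
  show "has_partial (\<lambda>g. arc_length (edge_length (d g)) i j k) i
        ((- ((cosh (l i k) + cosh (l j k) * cosh (l i j)) / sinh (l i j) * coth (d f i j))
          - (cosh (l i j) + cosh (l j k) * cosh (l i k)) / sinh (l i k) * coth (d f i k))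
            / hex_root (l j k) (l i j) (l i k)) f"
    using has_real_derivative_hexagon_arc[OF far[OF E(5,6) ne(1,3)] near[OF E(1)] near[OF E(3)]] ne
      l_pos[OF E(5)] l_pos[OF E(1)] l_pos[OF E(3)]
    by (simp add: has_partial_def arc_length_def l_def)
qed

text \<open>Expand the sine of \<open>(p + q) - p\<close>. With \<open>p\<close> and
  \<open>q\<close> the two parts of an edge, this trades coth for the ratio of sines that occurs in
  the product condition and the normal form.\<close>

lemma coth_eq_sinh_diff: "sinh q / sinh p = sinh (p + q) * coth p - cosh (p + q)"
  if "sinh p \<noteq> 0" for p q :: real
proof -
  have "sinh q = sinh ((p + q) - p)" by simp
  also have "\<dots> = sinh (p + q) * cosh p - cosh (p + q) * sinh p" by (rule sinh_diff)
  finally show ?thesis using that by (simp add: coth_def field_simps)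
qed

text \<open>In the new form the parts \<open>d\<close> enter only through ratios of sines. The two
  coefficients that remain are those of the Minkowski-orthogonal projection of \<open>v k\<close> to
  the plane of \<open>v i\<close> and \<open>v j\<close>, which is what the face center computation
  in \<open>tanh_pow_face\<close> produces.\<close>

lemma arc_derivative_numerator:
  fixes p q r s c :: real
  defines "a \<equiv> p + q" and "b \<equiv> r + s"
  assumes "sinh p \<noteq> 0" "sinh r \<noteq> 0" "sinh b \<noteq> 0"
  shows "sinh a * coth p - (cosh c + cosh a * cosh b) / sinh b * coth r =
    sinh q / sinh p - (cosh c + cosh b * cosh a) / (sinh b)\<^sup>2 * (sinh s / sinh r)
      - (cosh a + cosh b * cosh c) / (sinh b)\<^sup>2"
proof -
  have sq: "(cosh b)\<^sup>2 = (sinh b)\<^sup>2 + 1" by (simp add: cosh_square_eq)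
  \<comment> \<open>Rewriting both coth terms leaves \<open>cosh a\<close> minus
    \<open>cosh b\<close> times the first coefficient; this identity shows that the difference is
    minus the second coefficient.\<close>
  have "(cosh c + cosh b * cosh a) * cosh b - (cosh a + cosh b * cosh c)
      = cosh a * ((cosh b)\<^sup>2 - 1)"
    by (simp add: power2_eq_square algebra_simps)
  also have "\<dots> = cosh a * (sinh b)\<^sup>2" by (simp add: sq)
  finally have "(cosh c + cosh b * cosh a) / (sinh b)\<^sup>2 * cosh b
      - (cosh a + cosh b * cosh c) / (sinh b)\<^sup>2 = cosh a"
    using assms(5) by (simp add: field_simps)
  moreover have "K * x - y = z \<Longrightarrow> K * t = K' \<Longrightarrow>
      u - K' * v = (u - z) - K * (t * v - x) - y" for K K' x y z t u v :: real
    by (auto simp: algebra_simps)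
  moreover have "(cosh c + cosh b * cosh a) / (sinh b)\<^sup>2 * sinh b = (cosh c + cosh a * cosh b) / sinh b"
    using assms(5) by (simp add: power2_eq_square mult.commute)
  ultimately show ?thesis
    unfolding coth_eq_sinh_diff[OF assms(3)] coth_eq_sinh_diff[OF assms(4)] a_def[symmetric] b_def[symmetric]
    by blast
qed

lemma has_partial_arc_length_other_sinh:
  fixes d :: "real^'b::finite \<Rightarrow> 'b \<Rightarrow> 'b \<Rightarrow> real" and f :: "real^'b"
  defines "l \<equiv> edge_length (d f)"
  assumes dcs: "discrete_conformal_structure F \<Omega> d" and f: "f \<in> \<Omega>"
    and T: "T \<in> F" "i \<in> T" "j \<in> T" "k \<in> T" and ne: "i \<noteq> j" "j \<noteq> k" "i \<noteq> k"
    and nz: "d f j i \<noteq> 0" "d f j k \<noteq> 0"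
  shows "has_partial (\<lambda>g. arc_length (edge_length (d g)) i j k) j
      ((sinh (d f k j) / sinh (d f j k)
        - (cosh (l i k) + cosh (l i j) * cosh (l j k)) / (sinh (l i j))\<^sup>2 * (sinh (d f i j) / sinh (d f j i))
        - (cosh (l j k) + cosh (l i j) * cosh (l i k)) / (sinh (l i j))\<^sup>2)
            / hex_root (l j k) (l i j) (l i k)) f"
proof -
  have "0 < l i j"
    using dcs f oriented_edgesI[OF T(1,2,3) ne(1)]
    by (auto simp: discrete_conformal_structure_def l_def)
  moreover have "l j k = d f j k + d f k j" "l i j = d f j i + d f i j"
    by (simp_all add: l_def edge_length_def)
  ultimately show ?thesis
    using has_partial_arc_length_other[OF dcs f T ne]
      arc_derivative_numerator[of "d f j k" "d f j i" "d f i j" "d f k j" "l i k"] nz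
    by (simp add: l_def[symmetric])
qed

text \<open>All three derivatives are linear in the coth terms \<open>p\<close> and \<open>q\<close>
  with the same denominator, since \<open>hex_root\<close> is symmetric. The coefficients of
  \<open>p\<close> and of \<open>q\<close> agree separately, and both comparisons are instances of
  \<open>key\<close>, a consequence of cosh squared minus sinh squared being 1.\<close>

lemma arc_derivative_relation:
  fixes d :: "real^'b::finite \<Rightarrow> 'b \<Rightarrow> 'b \<Rightarrow> real" and f :: "real^'b"
  assumes dcs: "discrete_conformal_structure F \<Omega> d" and f: "f \<in> \<Omega>"
    and T: "T \<in> F" "i \<in> T" "j \<in> T" "k \<in> T" and ne: "i \<noteq> j" "j \<noteq> k" "i \<noteq> k"
  shows "\<exists>Di Dj Dk.
           has_partial (\<lambda>g. arc_length (edge_length (d g)) i j k) i Di f \<and>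
           has_partial (\<lambda>g. arc_length (edge_length (d g)) j i k) i Dj f \<and>
           has_partial (\<lambda>g. arc_length (edge_length (d g)) k i j) i Dk f \<and>
           Di = cosh (edge_length (d f) i j) * Dj + cosh (edge_length (d f) i k) * Dk"
proof -
  define l where "l = edge_length (d f)"
  note comm = edge_length_commute[of "d f"]
  have pos: "0 < l i j" "0 < l i k"
    using dcs f oriented_edgesI[OF T(1,2,3) ne(1)] oriented_edgesI[OF T(1,2,4) ne(3)]
    by (auto simp: discrete_conformal_structure_def l_def)
  define R where "R = hex_root (l j k) (l i j) (l i k)"
  define p q where "p = coth (d f i j)" and "q = coth (d f i k)"
  have self: "has_partial (\<lambda>g. arc_length (edge_length (d g)) i j k) i
        ((- ((cosh (l i k) + cosh (l j k) * cosh (l i j)) / sinh (l i j) * p)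
          - (cosh (l i j) + cosh (l j k) * cosh (l i k)) / sinh (l i k) * q) / R) f"
    unfolding l_def R_def p_def q_def by (rule has_partial_arc_length_self[OF dcs f T ne])
  have other_j: "has_partial (\<lambda>g. arc_length (edge_length (d g)) j i k) i
        ((sinh (l i k) * q
          - (cosh (l j k) + cosh (l i k) * cosh (l i j)) / sinh (l i j) * p) / R) f"
    using has_partial_arc_length_other[OF dcs f T(1,3,2,4)] ne
    by (simp add: l_def R_def p_def q_def comm[of j i] hex_root_commute ac_simps)
  have other_k: "has_partial (\<lambda>g. arc_length (edge_length (d g)) k i j) i
        ((sinh (l i j) * p
          - (cosh (l j k) + cosh (l i j) * cosh (l i k)) / sinh (l i k) * q) / R) f"
    using has_partial_arc_length_other[OF dcs f T(1,4,2,3)] ne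
    by (simp add: l_def R_def p_def q_def comm[of k i] comm[of k j] hex_root_commute ac_simps)
  have key: "(\<beta> + \<alpha> * cosh c) / sinh c = cosh c * ((\<alpha> + \<beta> * cosh c) / sinh c) - \<beta> * sinh c"
    if "0 < c" for \<alpha> \<beta> c :: real
  proof -
    have "cosh c * (\<alpha> + \<beta> * cosh c) - \<beta> * sinh c * sinh c = \<alpha> * cosh c + \<beta> * ((cosh c)\<^sup>2 - (sinh c)\<^sup>2)"
      by (simp add: algebra_simps power2_eq_square)
    also have "(cosh c)\<^sup>2 - (sinh c)\<^sup>2 = 1" by (simp add: cosh_square_eq)
    finally show ?thesis using that
      by (metis (no_types, lifting) add.commute diff_divide_distrib mult.right_neutral nonzero_mult_div_cancel_right
          sinh_real_pos_iff less_irrefl times_divide_eq_right)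
  qed
  have lin: "(- (m / s * p) - n / t * q) / R = x * ((t * q - y / s * p) / R) + z * ((s * p - y' / t * q) / R)"
    if "m / s = x * (y / s) - z * s" "n / t = z * (y' / t) - x * t" for m n s t x y y' z :: real
    unfolding that by (simp add: algebra_simps diff_divide_distrib add_divide_distrib)
  have "(- ((cosh (l i k) + cosh (l j k) * cosh (l i j)) / sinh (l i j) * p)
          - (cosh (l i j) + cosh (l j k) * cosh (l i k)) / sinh (l i k) * q) / R
     = cosh (l i j) * ((sinh (l i k) * q
          - (cosh (l j k) + cosh (l i k) * cosh (l i j)) / sinh (l i j) * p) / R)
     + cosh (l i k) * ((sinh (l i j) * p
          - (cosh (l j k) + cosh (l i j) * cosh (l i k)) / sinh (l i k) * q) / R)"
    by (rule lin[OF key[OF pos(1)] key[OF pos(2)]])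
  with self other_j other_k show ?thesis unfolding l_def by blast
qed

section \<open>Signs\<close>

text \<open>In either alternative of the sign condition the two values at one vertex of a face have
  the same nonzero sign. The case \<open>j = k\<close> is allowed and serves to get nonvanishing on
  a single edge.\<close>

lemma sign_condition_face:
  assumes "sign_condition F \<Omega> d" "f \<in> \<Omega>" "T \<in> F" "i \<in> T" "j \<in> T" "k \<in> T" "i \<noteq> j" "i \<noteq> k"
  shows "sgn (d f i j) = sgn (d f i k)" "d f i j \<noteq> 0"
proof -
  have "(\<forall>r\<in>T. \<forall>s\<in>T - {r}. d f r s > 0) \<or>
        (\<exists>i\<in>T. \<forall>s\<in>T - {i}. d f i s < 0 \<and> (\<forall>t\<in>T - {s}. d f s t > 0))"
    using assms by (auto simp: sign_condition_def)
  then have "(d f i j > 0 \<and> d f i k > 0) \<or> (d f i j < 0 \<and> d f i k < 0)"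
  proof (elim disjE bexE)
    fix r assume "r \<in> T" and r: "\<forall>s\<in>T - {r}. d f r s < 0 \<and> (\<forall>t\<in>T - {s}. d f s t > 0)"
    then show ?thesis using assms by (cases "i = r") auto
  qed (use assms in auto)
  then show "sgn (d f i j) = sgn (d f i k)" "d f i j \<noteq> 0" by auto
qed

lemma vertex_sign:
  fixes d :: "real^'b::finite \<Rightarrow> 'b \<Rightarrow> 'b \<Rightarrow> real"
  assumes surf: "closed_surface_triangulation F" and sign: "sign_condition F \<Omega> d"
  obtains \<epsilon> :: "'b \<Rightarrow> real" where "\<And>i. \<epsilon> i = 1 \<or> \<epsilon> i = -1"
    "\<And>f i j. f \<in> \<Omega> \<Longrightarrow> (i, j) \<in> oriented_edges F \<Longrightarrow> sgn (d f i j) = \<epsilon> i"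
proof
  define \<epsilon> :: "'b \<Rightarrow> real" where
    \<comment> \<open>One negative value anywhere decides the sign, as signs do not depend on the
      point of \<open>\<Omega>\<close> nor, by \<open>const\<close>, on the neighbour.\<close>
    "\<epsilon> i = (if \<exists>f\<in>\<Omega>. \<exists>j. (i, j) \<in> oriented_edges F \<and> d f i j < 0 then -1 else 1)" for i
  show "\<epsilon> i = 1 \<or> \<epsilon> i = -1" for i by (simp add: \<epsilon>_def)
  have const: "sgn (d f i a) = sgn (d f i b)"
    if f: "f \<in> \<Omega>" and "(i, a) \<in> oriented_edges F" "(i, b) \<in> oriented_edges F" for f i a b
  proof -
    \<comment> \<open>Walk from \<open>a\<close> to \<open>b\<close> in the link: consecutive
      vertices share a face with \<open>i\<close>, where the signs agree.\<close>
    have "(a, b) \<in> (link_edges F i)\<^sup>*"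
      using surf that unfolding closed_surface_triangulation_def by blast
    then show ?thesis
    proof induction
      case (step y z)
      then have "{i, y, z} \<in> F" "i \<noteq> y" "i \<noteq> z" by (auto simp: link_edges_def)
      with sign_condition_face(1)[OF sign f, of "{i, y, z}" i y z] step.IH show ?case by simp
    qed simp
  qed
  fix f i j assume f: "f \<in> \<Omega>" and ij: "(i, j) \<in> oriented_edges F"
  show "sgn (d f i j) = \<epsilon> i"
  proof (cases "\<exists>g\<in>\<Omega>. \<exists>a. (i, a) \<in> oriented_edges F \<and> d g i a < 0")
    case True
    then obtain g a where g: "g \<in> \<Omega>" "(i, a) \<in> oriented_edges F" "d g i a < 0" by blast
    have "sgn (d f i j) = sgn (d g i j)"
      using sign f g(1) ij unfolding sign_condition_def by blast
    also have "\<dots> = sgn (d g i a)" using const g ij by blast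
    finally show ?thesis using g True by (auto simp: \<epsilon>_def)
  next
    case False
    obtain T where "T \<in> F" "i \<in> T" "j \<in> T" "i \<noteq> j" using ij by (auto simp: oriented_edges_def)
    then have "d f i j \<noteq> 0" using sign_condition_face(2)[OF sign f, of T i j j] by simp
    moreover have "0 \<le> d f i j" using False f ij by force
    ultimately have "sgn (d f i j) = 1" by simp
    then show ?thesis unfolding \<epsilon>_def using False by simp
  qed
qed

section \<open>The change of variables\<close>

text \<open>The derivative is \<open>- q * exp (2 * x)\<close> times the cube of the function, so
  \<open>C_on_cubic_ode\<close> applies. The weights use \<open>p = 1\<close> with
  \<open>q = \<alpha>\<close>, and \<open>p = -1\<close> with \<open>q = 1\<close>.\<close>

lemma C_on_inverse_sqrt:
  fixes p q :: real
  assumes "open S" "\<And>x. x \<in> S \<Longrightarrow> 0 < p + q * exp (2 * x)"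
  shows "C_on k (\<lambda>x. 1 / sqrt (p + q * exp (2 * x))) S"
proof (rule C_on_cubic_ode[OF assms(1)])
  fix x assume "x \<in> S"
  from assms(2)[OF this] have G: "0 < p + q * exp (2 * x)" .
  define r where "r = sqrt (p + q * exp (2 * x))"
  have r: "r > 0" "p + q * exp (2 * x) = r\<^sup>2" using G by (simp_all add: r_def)
  have "((\<lambda>x. 1 / sqrt (p + q * exp (2 * x))) has_real_derivative
      - (inverse r / 2 * (q * (exp (2 * x) * 2))) / (r * r)) (at x)"
  proof -
    have "((\<lambda>x. p + q * exp (2 * x)) has_real_derivative q * (exp (2 * x) * 2)) (at x)"
      by (auto intro!: derivative_eq_intros)
    from DERIV_chain2[OF DERIV_real_sqrt[OF G] this]
    have "((\<lambda>x. sqrt (p + q * exp (2 * x))) has_real_derivative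
      inverse r / 2 * (q * (exp (2 * x) * 2))) (at x)"
      unfolding r_def .
    from DERIV_divide[OF DERIV_const[of 1] this] show ?thesis
      using r(1) unfolding r_def by simp
  qed
  also have "- (inverse r / 2 * (q * (exp (2 * x) * 2))) / (r * r)
      = (- q) * exp (2 * x) * (1 / r * (1 / r) * (1 / r))"
    using r(1) by (simp add: field_simps)
  finally show "((\<lambda>x. 1 / sqrt (p + q * exp (2 * x))) has_real_derivative
      (- q) * exp (2 * x) * (1 / sqrt (p + q * exp (2 * x)) * (1 / sqrt (p + q * exp (2 * x)))
        * (1 / sqrt (p + q * exp (2 * x))))) (at x)"
    by (simp add: r_def)
qed

text \<open>The set \<open>S\<close> will be a coordinate projection of \<open>\<Omega>\<close> and
  may be disconnected, so a positive derivative on \<open>S\<close> alone would not give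
  injectivity. An order-convex set \<open>I\<close> around \<open>S\<close> on which
  \<open>U\<close> increases repairs this.\<close>

lemma has_antiderivative_pos:
  fixes U w :: "real \<Rightarrow> real"
  assumes "open S" "S \<subseteq> I"
    and I: "\<And>x y z. x \<in> I \<Longrightarrow> y \<in> I \<Longrightarrow> x \<le> z \<Longrightarrow> z \<le> y \<Longrightarrow> z \<in> I"
    and der: "\<And>x. x \<in> I \<Longrightarrow> (U has_real_derivative w x) (at x)"
    and pos: "\<And>x. x \<in> I \<Longrightarrow> 0 < w x" and smooth: "\<And>k. C_on k w S"
  shows "inj_on U S \<and> smooth_on S U \<and> (\<forall>x\<in>S. (U has_real_derivative w x) (at x) \<and> 0 < w x)"
proof (intro conjI ballI)
  have less: "U x < U y" if "x \<in> S" "y \<in> S" "x < y" for x y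
    using that assms(2) I[of x y] der pos by (intro DERIV_pos_imp_increasing[OF that(3)]) blast
  show "inj_on U S"
    by (rule inj_onI) (metis less less_irrefl linorder_less_linear)
  show "smooth_on S U"
    using der assms(2) by (intro smooth_on_antiderivative[OF \<open>open S\<close> _ smooth]) blast
  show "(U has_real_derivative w x) (at x)" "0 < w x" if "x \<in> S" for x
    using der pos that assms(2) by blast+
qed

text \<open>The substitution \<open>y = exp (- x)\<close> turns the integrand into
  \<open>- 1 / sqrt (y\<^sup>2 + \<alpha>)\<close>, with antiderivative
  \<open>- ln (y + sqrt (y\<^sup>2 + \<alpha>))\<close>.\<close>

lemma weight_antiderivative_pos:
  fixes \<alpha> :: real
  assumes "open S" "\<And>x. x \<in> S \<Longrightarrow> 0 < 1 + \<alpha> * exp (2 * x)"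
  defines "w \<equiv> \<lambda>x. 1 / sqrt (1 + \<alpha> * exp (2 * x))"
  shows "\<exists>U. inj_on U S \<and> smooth_on S U \<and> (\<forall>x\<in>S. (U has_real_derivative w x) (at x) \<and> 0 < w x)"
proof (intro exI)
  define I where "I = {x. 0 < 1 + \<alpha> * exp (2 * x)}"
  define U where "U = (\<lambda>x. - ln (exp (- x) + sqrt (exp (- 2 * x) + \<alpha>)))"
  show "inj_on U S \<and> smooth_on S U \<and> (\<forall>x\<in>S. (U has_real_derivative w x) (at x) \<and> 0 < w x)"
  proof (rule has_antiderivative_pos[OF \<open>open S\<close>, of I])
    show "S \<subseteq> I" "\<And>x. x \<in> I \<Longrightarrow> 0 < w x" using assms by (auto simp: I_def w_def)
    show "C_on k w S" for k unfolding w_def by (rule C_on_inverse_sqrt[OF assms(1,2)])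
    \<comment> \<open>The set \<open>I\<close> is the whole line for nonnegative
      \<open>\<alpha>\<close> and a half-line unbounded to the left otherwise.\<close>
    show "z \<in> I" if "x \<in> I" "y \<in> I" "x \<le> z" "z \<le> y" for x y z
    proof (cases "\<alpha> \<ge> 0")
      case True
      then show ?thesis by (simp add: I_def add_pos_nonneg)
    next
      case False
      then have "\<alpha> * exp (2 * y) \<le> \<alpha> * exp (2 * z)" using that by simp
      with that(2) show ?thesis by (simp add: I_def)
    qed
    fix x assume "x \<in> I"
    then have G: "0 < 1 + \<alpha> * exp (2 * x)" by (simp add: I_def)
    define y r where "y = exp (- x)" and "r = sqrt (1 + \<alpha> * exp (2 * x))"
    have y: "y > 0" "r > 0" using G by (simp_all add: y_def r_def)
    have yy: "exp (- 2 * x) = y\<^sup>2" "exp (- (2 * x)) = y\<^sup>2"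
      by (simp_all add: y_def power2_eq_square exp_add[symmetric])
    have "y\<^sup>2 + \<alpha> = y\<^sup>2 * (1 + \<alpha> * exp (2 * x))"
      by (simp add: y_def distrib_left power2_eq_square exp_add[symmetric] mult.left_commute)
    then have Q: "exp (- 2 * x) + \<alpha> = (y * r)\<^sup>2" using G by (simp add: yy r_def power_mult_distrib)
    have sq: "sqrt (exp (- 2 * x) + \<alpha>) = y * r" unfolding Q using y by simp
    have "0 < exp (- 2 * x) + \<alpha>" unfolding Q using y by simp
    have "((\<lambda>x. exp (- 2 * x) + \<alpha>) has_real_derivative - 2 * y\<^sup>2) (at x)"
      by (auto intro!: derivative_eq_intros simp: yy)
    from DERIV_chain2[OF DERIV_real_sqrt[OF \<open>0 < exp (- 2 * x) + \<alpha>\<close>] this]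
    have "((\<lambda>x. sqrt (exp (- 2 * x) + \<alpha>)) has_real_derivative inverse (y * r) / 2 * (- 2 * y\<^sup>2)) (at x)"
      unfolding sq .
    moreover have "((\<lambda>x. exp (- x)) has_real_derivative - y) (at x)"
      by (auto intro!: derivative_eq_intros simp: y_def)
    ultimately have "((\<lambda>x. exp (- x) + sqrt (exp (- 2 * x) + \<alpha>)) has_real_derivative
        - y + inverse (y * r) / 2 * (- 2 * y\<^sup>2)) (at x)"
      by (rule DERIV_add[rotated])
    moreover have "exp (- x) + sqrt (exp (- 2 * x) + \<alpha>) = y + y * r" unfolding sq y_def ..
    moreover have "0 < y + y * r" using y by (simp add: add_pos_pos)
    ultimately have "(U has_real_derivative
        - (1 / (y + y * r) * (- y + inverse (y * r) / 2 * (- 2 * y\<^sup>2)))) (at x)"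
      unfolding U_def
      by (intro DERIV_minus DERIV_chain2[where g = "\<lambda>x. exp (- x) + sqrt (exp (- 2 * x) + \<alpha>)"])
        (auto intro!: DERIV_ln_divide)
    also have "- (1 / (y + y * r) * (- y + inverse (y * r) / 2 * (- 2 * y\<^sup>2))) = 1 / r"
    proof -
      have "- y + inverse (y * r) / 2 * (- 2 * y\<^sup>2) = - (y + y * r) / r"
        using y by (simp add: field_simps power2_eq_square)
      moreover have "- (1 / t * (- t / r)) = 1 / r" if "0 < t" for t using that by simp
      ultimately show ?thesis using \<open>0 < y + y * r\<close> by metis
    qed
    finally show "(U has_real_derivative w x) (at x)" by (simp add: w_def r_def)
  qed
qed

text \<open>Here \<open>y = exp (- x)\<close> gives the integrand
  \<open>- 1 / sqrt (1 - y\<^sup>2)\<close>, hence the arcsine; the half-line \<open>I\<close> is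
  where \<open>y < 1\<close>.\<close>

lemma weight_antiderivative_neg:
  assumes "open S" "\<And>x. x \<in> S \<Longrightarrow> 0 < - 1 + 1 * exp (2 * x)"
  defines "w \<equiv> \<lambda>x::real. 1 / sqrt (- 1 + 1 * exp (2 * x))"
  shows "\<exists>U. inj_on U S \<and> smooth_on S U \<and> (\<forall>x\<in>S. (U has_real_derivative w x) (at x) \<and> 0 < w x)"
proof (intro exI)
  define I where "I = {0::real<..}"
  define U where "U = (\<lambda>x::real. - arcsin (exp (- x)))"
  show "inj_on U S \<and> smooth_on S U \<and> (\<forall>x\<in>S. (U has_real_derivative w x) (at x) \<and> 0 < w x)"
  proof (rule has_antiderivative_pos[OF \<open>open S\<close>, of I])
    show "S \<subseteq> I" "\<And>x. x \<in> I \<Longrightarrow> 0 < w x" using assms(2) by (auto simp: I_def w_def)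
    show "C_on k w S" for k unfolding w_def by (rule C_on_inverse_sqrt[OF assms(1,2)])
    fix x assume "x \<in> I"
    then have x: "0 < x" by (simp add: I_def)
    define y where "y = exp (- x)"
    have y: "0 < y" "y < 1" using x by (simp_all add: y_def)
    have "1 - y\<^sup>2 = y\<^sup>2 * (- 1 + exp (2 * x))"
      by (simp add: y_def power2_eq_square exp_add[symmetric] algebra_simps)
    then have sq: "sqrt (1 - y\<^sup>2) = y * sqrt (- 1 + exp (2 * x))"
      using y by (simp add: real_sqrt_mult)
    have "(U has_real_derivative - (inverse (sqrt (1 - y\<^sup>2)) * (- y))) (at x)"
      unfolding U_def y_def
      using x by (intro DERIV_minus DERIV_chain2[where g = "\<lambda>x. exp (- x)"] DERIV_arcsin)
        (auto intro!: derivative_eq_intros simp: less_trans[OF _ exp_gt_zero])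
    then show "(U has_real_derivative w x) (at x)"
      using y unfolding sq w_def by (simp add: field_simps)
  qed (auto simp: I_def)
qed

lemma weight_antiderivative_exp:
  assumes "open S"
  defines "w \<equiv> \<lambda>x::real. exp (- x)"
  shows "\<exists>U. inj_on U S \<and> smooth_on S U \<and> (\<forall>x\<in>S. (U has_real_derivative w x) (at x) \<and> 0 < w x)"
proof (intro exI)
  show "inj_on (\<lambda>x. - exp (- x)) S \<and> smooth_on S (\<lambda>x. - exp (- x)) \<and>
      (\<forall>x\<in>S. ((\<lambda>x. - exp (- x)) has_real_derivative w x) (at x) \<and> 0 < w x)"
  proof (rule has_antiderivative_pos[OF \<open>open S\<close>, of UNIV])
    show "C_on k w S" for k
      using C_on_cmult_exp[OF \<open>open S\<close>, of k 1 "-1"] by (simp add: w_def)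
  qed (auto intro!: derivative_eq_intros simp: w_def)
qed

text \<open>Absolute values remove the undetermined signs of the normal form. The ratio of sines is
  then \<open>w j / w i\<close>, where the weight at \<open>i\<close> depends on
  \<open>f $ i\<close> only: the inverse square root of the absolute value of
  \<open>1 + \<alpha> $ i * exp (2 * f $ i)\<close>, or \<open>exp (- f $ i)\<close>.\<close>

lemma normal_form_weights:
  fixes d :: "real^'b::finite \<Rightarrow> 'b \<Rightarrow> 'b \<Rightarrow> real"
  assumes "open \<Omega>" "normal_form F \<Omega> d"
  obtains U w :: "'b \<Rightarrow> real \<Rightarrow> real" where
    "\<And>i. inj_on (U i) ((\<lambda>f. f $ i) ` \<Omega>) \<and> smooth_on ((\<lambda>f. f $ i) ` \<Omega>) (U i) \<and>
      (\<forall>x\<in>(\<lambda>f. f $ i) ` \<Omega>. (U i has_real_derivative w i x) (at x) \<and> 0 < w i x)"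
    "\<And>f i j. f \<in> \<Omega> \<Longrightarrow> (i, j) \<in> oriented_edges F \<Longrightarrow>
      \<bar>sinh (d f i j)\<bar> * w i (f $ i) = \<bar>sinh (d f j i)\<bar> * w j (f $ j)"
proof -
  note goal = that
  define S where "S i = (\<lambda>f. f $ i) ` \<Omega>" for i
  have S: "open (S i)" for i unfolding S_def by (rule open_coord_image[OF assms(1)])
  have *: thesis
    if w: "\<And>i. \<exists>U. inj_on U (S i) \<and> smooth_on (S i) U \<and>
        (\<forall>x\<in>S i. (U has_real_derivative w i x) (at x) \<and> 0 < w i x)"
      and ratio: "\<And>f i j. f \<in> \<Omega> \<Longrightarrow> (i, j) \<in> oriented_edges F \<Longrightarrow>
        \<bar>sinh (d f i j) / sinh (d f j i)\<bar> = w j (f $ j) / w i (f $ i)" for w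
  proof -
    from w obtain U where U: "\<And>i. inj_on (U i) (S i) \<and> smooth_on (S i) (U i) \<and>
        (\<forall>x\<in>S i. (U i has_real_derivative w i x) (at x) \<and> 0 < w i x)"
      by metis
    show thesis
    proof (rule goal)
      show "inj_on (U i) ((\<lambda>f. f $ i) ` \<Omega>) \<and> smooth_on ((\<lambda>f. f $ i) ` \<Omega>) (U i) \<and>
        (\<forall>x\<in>(\<lambda>f. f $ i) ` \<Omega>. (U i has_real_derivative w i x) (at x) \<and> 0 < w i x)" for i
        using U[of i] by (simp add: S_def)
      fix f i j assume f: "f \<in> \<Omega>" and ij: "(i, j) \<in> oriented_edges F"
      have "0 < w i (f $ i)" "0 < w j (f $ j)" using U f by (auto simp: S_def)
      \<comment> \<open>Division by zero yields 0, whereas the ratio of the weights is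
        positive.\<close>
      with ratio[OF f ij] have "sinh (d f j i) \<noteq> 0" by auto
      with ratio[OF f ij] \<open>0 < w i (f $ i)\<close>
      show "\<bar>sinh (d f i j)\<bar> * w i (f $ i) = \<bar>sinh (d f j i)\<bar> * w j (f $ j)"
        by (simp add: abs_divide field_simps)
    qed
  qed
  from assms(2) obtain \<alpha> :: "real^'b" where "let G = (\<lambda>f i. 1 + \<alpha> $ i * exp (2 * f $ i));
         ratio = (\<lambda>\<rho>. \<forall>f\<in>\<Omega>. \<forall>(i, j)\<in>oriented_edges F.
           sinh (d f i j) / sinh (d f j i) = \<rho> f i j \<or>
           sinh (d f i j) / sinh (d f j i) = - \<rho> f i j)
     in ((\<forall>f\<in>\<Omega>. \<forall>i. G f i > 0) \<and> ratio (\<lambda>f i j. sqrt (G f i / G f j))) \<or>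
        ((\<forall>i. \<alpha> $ i = -1) \<and> (\<forall>f\<in>\<Omega>. \<forall>i. G f i < 0) \<and>
           ratio (\<lambda>f i j. sqrt (G f i / G f j))) \<or>
        ratio (\<lambda>f i j. exp (f $ i - f $ j))"
    unfolding normal_form_def by blast
  then consider
    (pos) "\<And>f i. f \<in> \<Omega> \<Longrightarrow> 0 < 1 + \<alpha> $ i * exp (2 * f $ i)"
      "\<And>f i j. f \<in> \<Omega> \<Longrightarrow> (i, j) \<in> oriented_edges F \<Longrightarrow> \<bar>sinh (d f i j) / sinh (d f j i)\<bar> =
        \<bar>sqrt ((1 + \<alpha> $ i * exp (2 * f $ i)) / (1 + \<alpha> $ j * exp (2 * f $ j)))\<bar>"
  | (neg) "\<And>i. \<alpha> $ i = -1" "\<And>f i. f \<in> \<Omega> \<Longrightarrow> 1 + \<alpha> $ i * exp (2 * f $ i) < 0"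
      "\<And>f i j. f \<in> \<Omega> \<Longrightarrow> (i, j) \<in> oriented_edges F \<Longrightarrow> \<bar>sinh (d f i j) / sinh (d f j i)\<bar> =
        \<bar>sqrt ((1 + \<alpha> $ i * exp (2 * f $ i)) / (1 + \<alpha> $ j * exp (2 * f $ j)))\<bar>"
  | (exp) "\<And>f i j. f \<in> \<Omega> \<Longrightarrow> (i, j) \<in> oriented_edges F \<Longrightarrow> \<bar>sinh (d f i j) / sinh (d f j i)\<bar> =
        \<bar>exp (f $ i - f $ j)\<bar>"
    unfolding Let_def abs_eq_iff by blast
  then show thesis
  proof cases
    case pos
    show thesis
    proof (rule *)
      show "\<exists>U. inj_on U (S i) \<and> smooth_on (S i) U \<and> (\<forall>x\<in>S i.
        (U has_real_derivative 1 / sqrt (1 + \<alpha> $ i * exp (2 * x))) (at x) \<and>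
          0 < 1 / sqrt (1 + \<alpha> $ i * exp (2 * x)))" for i
        by (rule weight_antiderivative_pos[OF S]) (use pos(1) in \<open>auto simp: S_def\<close>)
      show "\<bar>sinh (d f i j) / sinh (d f j i)\<bar> =
        (1 / sqrt (1 + \<alpha> $ j * exp (2 * f $ j))) / (1 / sqrt (1 + \<alpha> $ i * exp (2 * f $ i)))"
        if "f \<in> \<Omega>" "(i, j) \<in> oriented_edges F" for f i j
        unfolding pos(2)[OF that] using pos(1)[OF that(1)] by (simp add: real_sqrt_divide less_imp_le)
    qed
  next
    case neg
    have gt: "0 < - 1 + 1 * exp (2 * f $ i)" if "f \<in> \<Omega>" for f i
      using neg(2)[OF that, of i] by (simp add: neg(1))
    show thesis
    proof (rule *)
      show "\<exists>U. inj_on U (S i) \<and> smooth_on (S i) U \<and> (\<forall>x\<in>S i.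
        (U has_real_derivative 1 / sqrt (- 1 + 1 * exp (2 * x))) (at x) \<and>
          0 < 1 / sqrt (- 1 + 1 * exp (2 * x)))" for i
        by (rule weight_antiderivative_neg[OF S]) (use gt in \<open>auto simp: S_def\<close>)
      show "\<bar>sinh (d f i j) / sinh (d f j i)\<bar> =
        (1 / sqrt (- 1 + 1 * exp (2 * f $ j))) / (1 / sqrt (- 1 + 1 * exp (2 * f $ i)))"
        if "f \<in> \<Omega>" "(i, j) \<in> oriented_edges F" for f i j
      proof -
        have "(1 + \<alpha> $ i * exp (2 * f $ i)) / (1 + \<alpha> $ j * exp (2 * f $ j))
          = (- (- 1 + 1 * exp (2 * f $ i))) / (- (- 1 + 1 * exp (2 * f $ j)))"
          by (simp add: neg(1))
        also have "\<dots> = (- 1 + 1 * exp (2 * f $ i)) / (- 1 + 1 * exp (2 * f $ j))"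
          by (rule minus_divide_divide)
        finally show ?thesis
          unfolding neg(3)[OF that] using gt[OF that(1), of i] gt[OF that(1), of j]
          by (simp add: real_sqrt_divide)
      qed
    qed
  next
    case exp
    show thesis
    proof (rule *)
      show "\<exists>U. inj_on U (S i) \<and> smooth_on (S i) U \<and> (\<forall>x\<in>S i.
        (U has_real_derivative exp (- x)) (at x) \<and> 0 < exp (- x))" for i
        by (rule weight_antiderivative_exp[OF S])
      show "\<bar>sinh (d f i j) / sinh (d f j i)\<bar> = exp (- f $ j) / exp (- f $ i)"
        if "f \<in> \<Omega>" "(i, j) \<in> oriented_edges F" for f i j
        unfolding exp(1)[OF that] by (simp add: exp_diff[symmetric])
    qed
  qed
qed

lemma symmetric_change_of_variables:
  fixes d :: "real^'b::finite \<Rightarrow> 'b \<Rightarrow> 'b \<Rightarrow> real"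
  assumes surf: "closed_surface_triangulation F"
    and dcs: "discrete_conformal_structure F \<Omega> d"
    and nf: "normal_form F \<Omega> d"
    and sign: "sign_condition F \<Omega> d"
  shows "\<exists>u. change_of_variables \<Omega> u \<and>
        (\<forall>f\<in>\<Omega>. \<forall>i j k. {i, j, k} \<in> F \<longrightarrow>
          (\<exists>D.
             has_partial (\<lambda>w. arc_length (edge_length (d (inv_into \<Omega> (coord_map u) w))) i j k) j D
               (coord_map u f) \<and>
             has_partial (\<lambda>w. arc_length (edge_length (d (inv_into \<Omega> (coord_map u) w))) j i k) i D
               (coord_map u f)))"
proof -
  have "open \<Omega>" using dcs by (simp add: discrete_conformal_structure_def)
  obtain \<epsilon> :: "'b \<Rightarrow> real" where \<epsilon>: "\<And>i. \<epsilon> i = 1 \<or> \<epsilon> i = -1"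
    and sgn: "\<And>f i j. f \<in> \<Omega> \<Longrightarrow> (i, j) \<in> oriented_edges F \<Longrightarrow> sgn (d f i j) = \<epsilon> i"
    using vertex_sign[OF surf sign] by blast
  obtain U w :: "'b \<Rightarrow> real \<Rightarrow> real" where
    U: "\<And>i. inj_on (U i) ((\<lambda>f. f $ i) ` \<Omega>) \<and> smooth_on ((\<lambda>f. f $ i) ` \<Omega>) (U i) \<and>
      (\<forall>x\<in>(\<lambda>f. f $ i) ` \<Omega>. (U i has_real_derivative w i x) (at x) \<and> 0 < w i x)" and
    w: "\<And>f i j. f \<in> \<Omega> \<Longrightarrow> (i, j) \<in> oriented_edges F \<Longrightarrow>
      \<bar>sinh (d f i j)\<bar> * w i (f $ i) = \<bar>sinh (d f j i)\<bar> * w j (f $ j)"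
    using normal_form_weights[OF \<open>open \<Omega>\<close> nf] by blast
  \<comment> \<open>With the vertex sign, the equation between absolute values becomes that
    \<open>sinh (d f i j)\<close> times the derivative of \<open>u i\<close> equals
    \<open>sinh (d f j i)\<close> times the derivative of \<open>u j\<close>.\<close>
  define u where "u i x = \<epsilon> i * U i x" for i x
  have inj: "inj_on (u i) ((\<lambda>f. f $ i) ` \<Omega>)" for i
    using U[of i] \<epsilon>[of i] unfolding inj_on_def u_def by auto
  have der: "(u i has_real_derivative \<epsilon> i * w i x) (at x)" if "x \<in> (\<lambda>f. f $ i) ` \<Omega>" for i x
    unfolding u_def using U[of i] that by (intro DERIV_cmult) blast
  have nz: "\<epsilon> i * w i x \<noteq> 0" if "x \<in> (\<lambda>f. f $ i) ` \<Omega>" for i x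
    using U[of i] that \<epsilon>[of i] by force
  have "change_of_variables \<Omega> u"
    unfolding change_of_variables_def
  proof (intro allI conjI ballI inj)
    fix i
    show "smooth_on ((\<lambda>f. f $ i) ` \<Omega>) (u i)"
      unfolding smooth_on_def
    proof
      fix k
      \<comment> \<open>The constant sign is written with \<open>exp (0 * x)\<close> so that
        \<open>C_on_cmult_exp\<close> supplies its smoothness.\<close>
      have "C_on k (\<lambda>x. (\<epsilon> i * exp (0 * x)) * U i x) ((\<lambda>f. f $ i) ` \<Omega>)"
        using U[of i] open_coord_image[OF \<open>open \<Omega>\<close>]
        by (intro C_on_mult C_on_cmult_exp) (auto simp: smooth_on_def)
      then show "C_on k (u i) ((\<lambda>f. f $ i) ` \<Omega>)" by (simp add: u_def[abs_def])
    qed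
    show "deriv (u i) x \<noteq> 0" if "x \<in> (\<lambda>f. f $ i) ` \<Omega>" for x
      using DERIV_imp_deriv[OF der[OF that]] nz[OF that] by simp
  qed
  moreover have "\<exists>D.
       has_partial (\<lambda>w. arc_length (edge_length (d (inv_into \<Omega> (coord_map u) w))) i j k) j D
         (coord_map u f) \<and>
       has_partial (\<lambda>w. arc_length (edge_length (d (inv_into \<Omega> (coord_map u) w))) j i k) i D
         (coord_map u f)"
    if f: "f \<in> \<Omega>" and ijk: "{i, j, k} \<in> F" for f i j k
  proof -
    note ne = face_distinct[OF surf ijk]
    define l where "l = edge_length (d f)"
    have E: "(i, j) \<in> oriented_edges F" "(j, i) \<in> oriented_edges F"
      using ne by (auto intro: oriented_edgesI[OF ijk])
    have dnz: "d f r s \<noteq> 0" if "r \<in> {i, j, k}" "s \<in> {i, j, k}" "r \<noteq> s" for r s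
      using sign_condition_face(2)[OF sign f ijk that(1,2,2,3,3)] .
    define D where "D i j = (sinh (d f k j) / sinh (d f j k)
        - (cosh (l i k) + cosh (l i j) * cosh (l j k)) / (sinh (l i j))\<^sup>2 * (sinh (d f i j) / sinh (d f j i))
        - (cosh (l j k) + cosh (l i j) * cosh (l i k)) / (sinh (l i j))\<^sup>2)
            / hex_root (l j k) (l i j) (l i k)" for i j
    have D: "has_partial (\<lambda>g. arc_length (edge_length (d g)) i j k) j (D i j) f"
      unfolding D_def l_def
      by (rule has_partial_arc_length_other_sinh[OF dcs f ijk]) (use ne dnz in auto)
    have D': "has_partial (\<lambda>g. arc_length (edge_length (d g)) j i k) i (D j i) f"
      unfolding D_def l_def
      by (rule has_partial_arc_length_other_sinh[OF dcs f ijk]) (use ne dnz in auto)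
    have prod: "sinh (d f i j) * sinh (d f j k) * sinh (d f k i) =
        sinh (d f j i) * sinh (d f k j) * sinh (d f i k)"
      using dcs f ijk unfolding discrete_conformal_structure_def by blast
    \<comment> \<open>After multiplication by the sine the \<open>A\<close> and \<open>B\<close>
      terms of the two sides coincide, with their roles exchanged. The remaining terms agree by the
      product condition.\<close>
    have symm: "D i j * sinh (d f j i) = D j i * sinh (d f i j)"
    proof -
      define R A B where "R = hex_root (l j k) (l i j) (l i k)"
        and "A = (cosh (l i k) + cosh (l i j) * cosh (l j k)) / (sinh (l i j))\<^sup>2"
        and "B = (cosh (l j k) + cosh (l i j) * cosh (l i k)) / (sinh (l i j))\<^sup>2"
      have comm: "l j i = l i j" by (simp add: l_def edge_length_commute)
      have hr: "hex_root (l i k) (l i j) (l j k) = hex_root (l j k) (l i j) (l i k)"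
        by (simp add: hex_root_def algebra_simps)
      have Dij: "D i j = (sinh (d f k j) / sinh (d f j k) - A * (sinh (d f i j) / sinh (d f j i)) - B) / R"
        unfolding D_def A_def B_def R_def ..
      have Dji: "D j i = (sinh (d f k i) / sinh (d f i k) - B * (sinh (d f j i) / sinh (d f i j)) - A) / R"
        unfolding D_def A_def B_def R_def comm hr ..
      have "sinh (d f k j) / sinh (d f j k) * sinh (d f j i) = sinh (d f k i) / sinh (d f i k) * sinh (d f i j)"
        using prod dnz[of i k] dnz[of j k] ne by (simp add: field_simps)
      moreover have "sinh (d f i j) \<noteq> 0" "sinh (d f j i) \<noteq> 0" using dnz ne by auto
      moreover have "(x - A * (p / q) - B) / R * q = (y - B * (q / p) - A) / R * p"
        if "x * q = y * p" "p \<noteq> 0" "q \<noteq> 0" for x y p q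
      proof -
        have "(x - A * (p / q) - B) * q = (y - B * (q / p) - A) * p"
          using that by (simp add: left_diff_distrib)
        then show ?thesis by (simp only: times_divide_eq_left)
      qed
      ultimately show ?thesis unfolding Dij Dji by blast
    qed
    have si: "sinh (d f i j) = \<epsilon> i * \<bar>sinh (d f i j)\<bar>" "sinh (d f j i) = \<epsilon> j * \<bar>sinh (d f j i)\<bar>"
    proof -
      have "sinh x = sgn x * \<bar>sinh x\<bar>" for x :: real by (auto simp: sgn_if abs_if)
      from this[of "d f i j"] this[of "d f j i"]
      show "sinh (d f i j) = \<epsilon> i * \<bar>sinh (d f i j)\<bar>" "sinh (d f j i) = \<epsilon> j * \<bar>sinh (d f j i)\<bar>"
        by (simp_all only: sgn[OF f E(1)] sgn[OF f E(2)])
    qed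
    have "D i j / (\<epsilon> j * w j (f $ j)) = D j i / (\<epsilon> i * w i (f $ i))"
    proof -
      define s t where "s = \<bar>sinh (d f i j)\<bar>" and "t = \<bar>sinh (d f j i)\<bar>"
      have st: "s \<noteq> 0" "t \<noteq> 0" using dnz ne by (auto simp: s_def t_def)
      have wpos: "w i (f $ i) \<noteq> 0" "w j (f $ j) \<noteq> 0" using nz[of "f $ i" i] nz[of "f $ j" j] f by auto
      have inv: "a / (\<epsilon> m * b) = a * \<epsilon> m / b" for a b m using \<epsilon>[of m] by auto
      have 1: "D i j * \<epsilon> j * t = D j i * \<epsilon> i * s"
        using symm unfolding si[folded s_def t_def] by (simp add: mult.assoc)
      have 2: "s * w i (f $ i) = t * w j (f $ j)" using w[OF f E(1)] by (simp add: s_def t_def)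
      have "D i j * \<epsilon> j / w j (f $ j) = D i j * \<epsilon> j * t / (t * w j (f $ j))" using st by simp
      also have "\<dots> = D j i * \<epsilon> i * s / (s * w i (f $ i))" by (simp only: 1 2)
      also have "\<dots> = D j i * \<epsilon> i / w i (f $ i)" using st by simp
      finally show ?thesis by (simp only: inv)
    qed
    moreover have "has_partial (\<lambda>y. arc_length (edge_length (d (inv_into \<Omega> (coord_map u) y))) i j k) j
        (D i j / (\<epsilon> j * w j (f $ j))) (coord_map u f)"
      by (rule has_partial_change_of_coordinates[OF \<open>open \<Omega>\<close> f inj der _ D]) (use nz f in auto)
    moreover have "has_partial (\<lambda>y. arc_length (edge_length (d (inv_into \<Omega> (coord_map u) y))) j i k) i
        (D j i / (\<epsilon> i * w i (f $ i))) (coord_map u f)"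
      by (rule has_partial_change_of_coordinates[OF \<open>open \<Omega>\<close> f inj der _ D']) (use nz f in auto)
    ultimately show ?thesis by metis
  qed
  ultimately show ?thesis by blast
qed

section \<open>Minkowski geometry\<close>

lemma mink_commute: "mink x y = mink y x"
  by (simp add: mink_def algebra_simps)

lemma mink_simps [simp]:
  "mink (x + y) z = mink x z + mink y z" "mink z (x + y) = mink z x + mink z y"
  "mink (x - y) z = mink x z - mink y z" "mink z (x - y) = mink z x - mink z y"
  "mink (- x) z = - mink x z" "mink z (- x) = - mink z x"
  "mink (t *\<^sub>R x) z = t * mink x z" "mink z (t *\<^sub>R x) = t * mink z x"
  "mink 0 z = 0" "mink z 0 = 0"
  by (simp_all add: mink_def algebra_simps)

text \<open>Let \<open>w\<close> be the Euclidean cross product of \<open>x\<close> and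
  \<open>y\<close>. A Lagrange identity gives the difference of the two sides as
  \<open>w1\<^sup>2 + w2\<^sup>2 - w3\<^sup>2\<close>. Since \<open>w\<close> is
  Euclidean-orthogonal to the time-like \<open>y\<close>, its third component is dominated by the
  other two.\<close>

lemma reverse_Cauchy_Schwarz:
  assumes "mink y y < 0"
  shows "mink x x * mink y y \<le> (mink x y)\<^sup>2"
proof -
  define w1 w2 w3 where w: "w1 = x$2 * y$3 - x$3 * y$2" "w2 = x$3 * y$1 - x$1 * y$3"
    "w3 = x$1 * y$2 - x$2 * y$1"
  have y: "(y$1)\<^sup>2 + (y$2)\<^sup>2 < (y$3)\<^sup>2" using assms by (simp add: mink_def power2_eq_square)
  then have y3: "0 < (y$3)\<^sup>2" by (meson le_less_trans sum_power2_ge_zero)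
  have "w3 * y$3 = - (w1 * y$1 + w2 * y$2)" by (simp add: w algebra_simps)
  then have "w3\<^sup>2 * (y$3)\<^sup>2 = (w1 * y$1 + w2 * y$2)\<^sup>2" by (metis power2_minus power_mult_distrib)
  also have "\<dots> \<le> (w1\<^sup>2 + w2\<^sup>2) * ((y$1)\<^sup>2 + (y$2)\<^sup>2)"
  proof -
    have "(w1\<^sup>2 + w2\<^sup>2) * ((y$1)\<^sup>2 + (y$2)\<^sup>2) - (w1 * y$1 + w2 * y$2)\<^sup>2 = (w1 * y$2 - w2 * y$1)\<^sup>2"
      by (simp add: power2_eq_square algebra_simps)
    then show ?thesis by (metis diff_ge_0_iff_ge zero_le_power2)
  qed
  also have "\<dots> \<le> (w1\<^sup>2 + w2\<^sup>2) * (y$3)\<^sup>2" using y by (intro mult_left_mono) auto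
  finally have "w3\<^sup>2 \<le> w1\<^sup>2 + w2\<^sup>2" using y3 by (simp add: mult_le_cancel_right)
  moreover have "(mink x y)\<^sup>2 - mink x x * mink y y = w1\<^sup>2 + w2\<^sup>2 - w3\<^sup>2"
    by (simp add: w mink_def power2_eq_square algebra_simps)
  ultimately show ?thesis by simp
qed

text \<open>Cauchy-Schwarz in the first two coordinates, followed by a comparison of the third ones,
  where the defect is the square of \<open>x$3 - y$3\<close>.\<close>

lemma H2_mink_le:
  assumes "x \<in> H2" "y \<in> H2"
  shows "mink x y \<le> -1"
proof -
  have x: "(x$1)\<^sup>2 + (x$2)\<^sup>2 = (x$3)\<^sup>2 - 1" "0 < x$3" and y: "(y$1)\<^sup>2 + (y$2)\<^sup>2 = (y$3)\<^sup>2 - 1" "0 < y$3"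
    using assms by (auto simp: H2_def mink_def power2_eq_square)
  have "1 \<le> (x$3)\<^sup>2" "1 \<le> (y$3)\<^sup>2"
    using x(1) y(1) sum_power2_ge_zero[of "x$1" "x$2"] sum_power2_ge_zero[of "y$1" "y$2"] by linarith+
  then have "1 \<le> x$3" "1 \<le> y$3"
    using x(2) y(2) power2_le_imp_le[of 1 "x$3"] power2_le_imp_le[of 1 "y$3"] by simp_all
  then have 1: "1 \<le> x$3 * y$3" using mult_mono[of 1 "x$3" 1 "y$3"] by simp
  have "(x$1 * y$1 + x$2 * y$2)\<^sup>2 \<le> ((x$1)\<^sup>2 + (x$2)\<^sup>2) * ((y$1)\<^sup>2 + (y$2)\<^sup>2)"
  proof -
    have "((x$1)\<^sup>2 + (x$2)\<^sup>2) * ((y$1)\<^sup>2 + (y$2)\<^sup>2) - (x$1 * y$1 + x$2 * y$2)\<^sup>2 = (x$1 * y$2 - x$2 * y$1)\<^sup>2"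
      by (simp add: power2_eq_square algebra_simps)
    then show ?thesis by (metis diff_ge_0_iff_ge zero_le_power2)
  qed
  also have "\<dots> \<le> (x$3 * y$3 - 1)\<^sup>2"
  proof -
    have "(x$3 * y$3 - 1)\<^sup>2 - ((x$3)\<^sup>2 - 1) * ((y$3)\<^sup>2 - 1) = (x$3 - y$3)\<^sup>2"
      by (simp add: power2_eq_square algebra_simps)
    then show ?thesis unfolding x y by (metis diff_ge_0_iff_ge zero_le_power2)
  qed
  finally have "x$1 * y$1 + x$2 * y$2 \<le> x$3 * y$3 - 1" by (rule power2_le_imp_le) (use 1 in simp)
  then show ?thesis by (simp add: mink_def)
qed

text \<open>A vector on the lower sheet has its negative in \<open>H2\<close>, so its product with
  \<open>e\<close> would be positive.\<close>

lemma H2_I: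
  assumes "mink x x = -1" "e \<in> H2" "mink x e < 0"
  shows "x \<in> H2"
proof -
  have "x$3 \<noteq> 0"
  proof
    assume "x$3 = 0"
    then have "x$1 * x$1 + x$2 * x$2 = -1" using assms(1) by (simp add: mink_def)
    then show False using sum_squares_ge_zero[of "x$1" "x$2"] by linarith
  qed
  moreover have "\<not> x$3 < 0"
  proof
    assume "x$3 < 0"
    then have "- x \<in> H2" using assms(1) by (simp add: H2_def)
    from H2_mink_le[OF this assms(2)] assms(3) show False by simp
  qed
  ultimately show ?thesis using assms(1) by (simp add: H2_def)
qed

text \<open>The Gram determinant of \<open>a\<close>, \<open>b\<close>, \<open>n\<close> is minus
  the square of their determinant \<open>D\<close>, so \<open>D\<close> is nonzero and Cramer's rule
  gives the components of \<open>r\<close>.\<close>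

lemma mink_nondegenerate:
  assumes "mink a r = 0" "mink b r = 0" "mink n r = 0"
    and n: "mink n a = 0" "mink n b = 0"
    and gram: "mink n n * (mink a a * mink b b - (mink a b)\<^sup>2) \<noteq> 0"
  shows "r = 0"
proof -
  define D where "D = a$1 * (b$2 * n$3 - b$3 * n$2) - a$2 * (b$1 * n$3 - b$3 * n$1)
    + a$3 * (b$1 * n$2 - b$2 * n$1)"
  have "mink n n * (mink a a * mink b b - (mink a b)\<^sup>2)
      - mink a a * (mink n b)\<^sup>2 - mink b b * (mink n a)\<^sup>2 + 2 * mink a b * mink n a * mink n b = - D\<^sup>2"
    unfolding mink_def D_def power2_eq_square by algebra
  then have "D \<noteq> 0" using gram n by auto
  have D: "D * r$1 = (b$2 * n$3 - b$3 * n$2) * mink a r - (a$2 * n$3 - a$3 * n$2) * mink b r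
      + (a$2 * b$3 - a$3 * b$2) * mink n r"
    "D * r$2 = - (b$1 * n$3 - b$3 * n$1) * mink a r + (a$1 * n$3 - a$3 * n$1) * mink b r
      - (a$1 * b$3 - a$3 * b$1) * mink n r"
    "D * r$3 = - ((b$1 * n$2 - b$2 * n$1) * mink a r - (a$1 * n$2 - a$2 * n$1) * mink b r
      + (a$1 * b$2 - a$2 * b$1) * mink n r)"
    unfolding mink_def D_def by algebra+
  then have "r$1 = 0" "r$2 = 0" "r$3 = 0" using assms(1-3) \<open>D \<noteq> 0\<close> by auto
  then show ?thesis by (simp add: vec_eq_iff forall_3)
qed

lemma in_span_pair: "x \<in> span {a, b} \<longleftrightarrow> (\<exists>s t. x = s *\<^sub>R a + t *\<^sub>R b)"
  for a b x :: "'a::real_vector"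
  by (auto simp: span_insert span_singleton algebra_simps)

lemma plane_normal_decomposition:
  assumes "mink a a = 1" "mink b b = 1" "mink a b = - C" "C > 1"
    and n: "mink n a = 0" "mink n b = 0" "mink n n = 1"
  shows "\<exists>s t. x = s *\<^sub>R a + t *\<^sub>R b + mink n x *\<^sub>R n"
proof -
  \<comment> \<open>Solution of the linear system for the products with \<open>a\<close> and
    \<open>b\<close>; its Gram matrix has determinant \<open>1 - C\<^sup>2\<close>.\<close>
  define s t where "s = (mink a x + C * mink b x) / (1 - C\<^sup>2)" and "t = (mink b x + C * mink a x) / (1 - C\<^sup>2)"
  have C: "1 < C\<^sup>2" using assms(4) by (simp add: one_less_power)
  define r where "r = x - (s *\<^sub>R a + t *\<^sub>R b + mink n x *\<^sub>R n)"
  have comm: "mink b a = - C" "mink a n = 0" "mink b n = 0" using assms by (simp_all add: mink_commute)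
  have "s - t * C = mink a x" "t - s * C = mink b x"
    using C unfolding s_def t_def by (simp_all add: divide_simps) (simp_all add: power2_eq_square algebra_simps)
  then have "mink a r = 0" "mink b r = 0" "mink n r = 0"
    using assms comm by (simp_all add: r_def algebra_simps)
  moreover have "mink n n * (mink a a * mink b b - (mink a b)\<^sup>2) \<noteq> 0"
    unfolding assms power2_minus mult_1 using C by linarith
  ultimately have "r = 0" using n by (intro mink_nondegenerate)
  then show ?thesis unfolding r_def by (metis eq_iff_diff_eq_0)
qed

lemma in_span_iff_normal:
  assumes "mink a a = 1" "mink b b = 1" "mink a b = - C" "C > 1"
    and "mink n a = 0" "mink n b = 0" "mink n n = 1"
  shows "x \<in> span {a, b} \<longleftrightarrow> mink n x = 0"
proof
  assume "x \<in> span {a, b}"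
  then show "mink n x = 0" using assms by (auto simp: in_span_pair)
next
  assume "mink n x = 0"
  with plane_normal_decomposition[OF assms, of x] show "x \<in> span {a, b}"
    by (auto simp: in_span_pair)
qed

lemma perp_perp_eq_normal:
  assumes "mink a a = 1" "mink b b = 1" "mink a b = - C" "C > 1"
    and "mink n a = 0" "mink n b = 0" "mink n n = 1"
    and x: "mink a x = 0" "mink b x = 0"
  shows "x = mink n x *\<^sub>R n"
proof -
  have an: "mink a n = 0" "mink b n = 0" using assms(5,6) by (simp_all add: mink_commute)
  have "1 < C\<^sup>2" using assms(4) by (simp add: one_less_power)
  then have "mink n n * (mink a a * mink b b - (mink a b)\<^sup>2) \<noteq> 0"
    unfolding assms power2_minus mult_1 by linarith
  moreover have "mink a (x - mink n x *\<^sub>R n) = 0" "mink b (x - mink n x *\<^sub>R n) = 0"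
    "mink n (x - mink n x *\<^sub>R n) = 0"
    using x assms(7) an by simp_all
  ultimately have "x - mink n x *\<^sub>R n = 0"
    using assms(5,6) by (intro mink_nondegenerate)
  then show ?thesis by simp
qed

section \<open>Distances to an edge line\<close>

lemma tanh_arcosh: "m \<ge> 1 \<Longrightarrow> tanh (arcosh m) = sqrt (m\<^sup>2 - 1) / m" for m :: real
  by (simp add: tanh_def sinh_arcosh_real)

lemma hsetdist_eq:
  assumes "x0 \<in> X" "y0 \<in> Y" "- mink x0 y0 = m" "1 \<le> m"
    and "\<And>x y. x \<in> X \<Longrightarrow> y \<in> Y \<Longrightarrow> m \<le> - mink x y"
  shows "hsetdist X Y = arcosh m"
  unfolding hsetdist_def
proof (rule cInf_eq_minimum)
  show "arcosh m \<in> {hdist x y |x y. x \<in> X \<and> y \<in> Y}"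
    using assms(1-3) by (auto simp: hdist_def)
  fix z assume "z \<in> {hdist x y |x y. x \<in> X \<and> y \<in> Y}"
  then obtain x y where "x \<in> X" "y \<in> Y" and z: "z = arcosh (- mink x y)" by (auto simp: hdist_def)
  with assms(5) have "m \<le> - mink x y" by blast
  then show "arcosh m \<le> z"
    unfolding z using assms(4) arcosh_real_strict_mono[of m "- mink x y"]
    by (cases "m = - mink x y") (simp_all add: less_imp_le)
qed

text \<open>The edge center \<open>e\<close> is the foot of the perpendicular: the product of
  \<open>c\<close> with \<open>y\<close> is \<open>A\<close> times that of \<open>e\<close> with
  \<open>y\<close>, which is extremal at \<open>y = e\<close>. The distance has cosine
  \<open>A / s\<close> and sine \<open>\<bar>B\<bar> / s\<close>.\<close>

lemma tanh_dist_time_like: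
  assumes e: "e \<in> L" and L: "\<And>y. y \<in> L \<Longrightarrow> y \<in> H2 \<and> mink n y = 0" and n: "mink n n = 1"
    and c: "c = A *\<^sub>R e + B *\<^sub>R n" "0 < A" "B\<^sup>2 < A\<^sup>2"
  shows "tanh (hsetdist {(1 / sqrt (- mink c c)) *\<^sub>R c} L) = \<bar>B\<bar> / A"
proof -
  have ee: "mink e e = -1" "mink n e = 0" "mink e n = 0"
    using L[OF e] by (auto simp: H2_def mink_commute)
  define s where "s = sqrt (A\<^sup>2 - B\<^sup>2)"
  have s: "0 < s" "s\<^sup>2 = A\<^sup>2 - B\<^sup>2" using c(3) by (simp_all add: s_def)
  have cc: "sqrt (- mink c c) = s"
    by (simp add: c(1) ee n s_def power2_eq_square)
  have "s\<^sup>2 \<le> A\<^sup>2" using s by simp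
  then have "s \<le> A" using c(2) s(1) by (simp add: power2_le_iff_abs_le)
  then have m: "1 \<le> A / s" using s by simp
  have "hsetdist {(1 / sqrt (- mink c c)) *\<^sub>R c} L = arcosh (A / s)"
  proof (rule hsetdist_eq)
    show "- mink ((1 / sqrt (- mink c c)) *\<^sub>R c) e = A / s"
      unfolding cc by (simp add: c(1) ee)
    fix x y assume "x \<in> {(1 / sqrt (- mink c c)) *\<^sub>R c}" and y: "y \<in> L"
    then have "- mink x y = (A / s) * - mink e y"
      unfolding cc using L[OF y] by (simp add: c(1))
    moreover have "1 \<le> - mink e y" using H2_mink_le L e y by fastforce
    ultimately show "A / s \<le> - mink x y" using m mult_left_mono[of 1 "- mink e y" "A / s"] by simp
  qed (use e m in auto)
  moreover have "(A / s)\<^sup>2 - 1 = (B / s)\<^sup>2" using s by (simp add: field_simps)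
  ultimately show ?thesis using m s by (simp add: tanh_arcosh)
qed

text \<open>The common perpendicular of the two geodesics is the normal line through
  \<open>e\<close>; it meets them in \<open>x0\<close> and \<open>e\<close>. The distance has cosine
  \<open>\<bar>B\<bar> / s\<close> and sine \<open>A / s\<close>.\<close>

lemma tanh_dist_space_like:
  assumes e: "e \<in> L" and L: "\<And>y. y \<in> L \<Longrightarrow> y \<in> H2 \<and> mink n y = 0" and n: "mink n n = 1"
    and c: "c = A *\<^sub>R e + B *\<^sub>R n" "0 < A" "A\<^sup>2 < B\<^sup>2"
  shows "tanh (hsetdist (perp c \<inter> H2) L) = A / \<bar>B\<bar>"
proof -
  have ee: "mink e e = -1" "mink n e = 0" "mink e n = 0"
    using L[OF e] by (auto simp: H2_def mink_commute)
  define s where "s = sqrt (B\<^sup>2 - A\<^sup>2)"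
  have s: "0 < s" "s\<^sup>2 = B\<^sup>2 - A\<^sup>2" using c(3) by (simp_all add: s_def)
  have B: "B \<noteq> 0" using c by auto
  have "s\<^sup>2 \<le> B\<^sup>2" using s by simp
  then have "s \<le> \<bar>B\<bar>" using s(1) by (metis abs_le_square_iff abs_of_pos)
  then have m: "1 \<le> \<bar>B\<bar> / s" using s by simp
  \<comment> \<open>The combination of \<open>e\<close> and \<open>n\<close> orthogonal to
    \<open>c\<close>, normalized; the factor \<open>sgn B\<close> selects the upper sheet.\<close>
  define x0 where "x0 = (sgn B / s) *\<^sub>R (B *\<^sub>R e + A *\<^sub>R n)"
  have "sgn B * B = \<bar>B\<bar>" "sgn B * sgn B = 1" using B by (auto simp: sgn_if)
  then have x0e: "- mink x0 e = \<bar>B\<bar> / s" by (simp add: x0_def ee)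
  define \<kappa> where "\<kappa> = sgn B / s"
  have "\<kappa>\<^sup>2 * s\<^sup>2 = 1" using B s(1) by (simp add: \<kappa>_def power_divide sgn_if)
  have "mink x0 x0 = \<kappa>\<^sup>2 * (A\<^sup>2 - B\<^sup>2)"
    unfolding x0_def \<kappa>_def[symmetric] by (simp add: ee n power2_eq_square right_diff_distrib)
  also have "\<dots> = - (\<kappa>\<^sup>2 * s\<^sup>2)" unfolding s(2) by (simp add: algebra_simps)
  also have "\<dots> = -1" using \<open>\<kappa>\<^sup>2 * s\<^sup>2 = 1\<close> by simp
  finally have "x0 \<in> H2" by (rule H2_I[of _ e]) (use L[OF e] x0e m in auto)
  moreover have "x0 \<in> perp c" by (simp add: perp_def x0_def c(1) ee n)
  ultimately have x0: "x0 \<in> perp c \<inter> H2" by blast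
  have "hsetdist (perp c \<inter> H2) L = arcosh (\<bar>B\<bar> / s)"
  proof (rule hsetdist_eq[OF x0 e x0e m])
    fix x y assume x: "x \<in> perp c \<inter> H2" and y: "y \<in> L"
    define \<mu> where "\<mu> = mink n x"
    have xx: "mink (x - \<mu> *\<^sub>R n) (x - \<mu> *\<^sub>R n) = - (1 + \<mu>\<^sup>2)"
      using x n by (simp add: H2_def \<mu>_def mink_commute[of x n] power2_eq_square)
    \<comment> \<open>Reverse Cauchy-Schwarz for the projection of \<open>x\<close> to the plane of
      \<open>L\<close>. Orthogonality to \<open>c\<close> ties \<open>\<mu>\<close> to the product
      with \<open>e\<close>, which bounds \<open>1 + \<mu>\<^sup>2\<close> from below.\<close>
    have bound: "1 + \<mu>\<^sup>2 \<le> (mink x z)\<^sup>2" if "z \<in> L" for z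
    proof -
      have "mink z z = -1" "mink n z = 0" using L[OF that] by (auto simp: H2_def)
      with reverse_Cauchy_Schwarz[of z "x - \<mu> *\<^sub>R n"] show ?thesis by (simp add: xx del: mink_simps(3,4) add: mink_simps(3)[of _ _ z])
    qed
    have "A * mink x e = - (B * \<mu>)"
      using x by (simp add: perp_def c(1) \<mu>_def mink_commute[of x e])
    then have "A\<^sup>2 * (mink x e)\<^sup>2 = B\<^sup>2 * \<mu>\<^sup>2" by (metis power2_minus power_mult_distrib)
    moreover have "A\<^sup>2 * (1 + \<mu>\<^sup>2) \<le> A\<^sup>2 * (mink x e)\<^sup>2"
      using bound[OF e] by (intro mult_left_mono) auto
    ultimately have "B\<^sup>2 \<le> (1 + \<mu>\<^sup>2) * s\<^sup>2" by (simp add: s algebra_simps)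
    then have "(\<bar>B\<bar> / s)\<^sup>2 \<le> 1 + \<mu>\<^sup>2" using s(1) by (simp add: power_divide divide_le_eq)
    also have "\<dots> \<le> (- mink x y)\<^sup>2" using bound[OF y] by simp
    finally show "\<bar>B\<bar> / s \<le> - mink x y"
      by (rule power2_le_imp_le) (use H2_mink_le[of x y] x L[OF y] in auto)
  qed
  moreover have "(\<bar>B\<bar> / s)\<^sup>2 - 1 = (A / s)\<^sup>2"
  proof -
    have "B\<^sup>2 = A\<^sup>2 + s\<^sup>2" using s(2) by simp
    then show ?thesis using s(1) by (simp add: power_divide add_divide_distrib)
  qed
  ultimately show ?thesis using m s c(2) by (simp add: tanh_arcosh)
qed

section \<open>The realized hexagon\<close>

text \<open>Orthogonality makes \<open>p\<close> and \<open>q\<close> multiples of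
  \<open>b - g a\<close> and \<open>a - g b\<close>, where \<open>g\<close> is the product of
  \<open>a\<close> and \<open>b\<close>. The half-plane conditions make both factors positive, and
  the product of \<open>p\<close> and \<open>q\<close> turns out to be \<open>g\<close> itself, so
  the distance determines \<open>g\<close>.\<close>

lemma realization_gram:
  assumes aa: "mink a a = 1" and bb: "mink b b = 1" and l: "0 < l"
    and p: "p \<in> span {a, b}" "p \<in> H2" "mink a p = 0" "mink b p \<le> 0"
    and q: "q \<in> span {a, b}" "q \<in> H2" "mink b q = 0" "mink a q \<le> 0"
    and dist: "hdist p q = l"
  shows "mink a b = - cosh l" and "sinh l *\<^sub>R p = b + cosh l *\<^sub>R a"
proof -
  define g where "g = mink a b"
  have ba: "mink b a = g" by (simp add: g_def mink_commute)
  obtain y' y where p': "p = y' *\<^sub>R a + y *\<^sub>R b" using p(1) by (auto simp: in_span_pair)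
  obtain z z' where q': "q = z *\<^sub>R a + z' *\<^sub>R b" using q(1) by (auto simp: in_span_pair)
  have y': "y' = - g * y" using p(3) by (simp add: p' aa g_def[symmetric] eq_neg_iff_add_eq_0 mult.commute)
  have z': "z' = - g * z" using q(3) by (simp add: q' bb ba eq_neg_iff_add_eq_0 mult.commute add.commute)
  have pp: "y\<^sup>2 * (g\<^sup>2 - 1) = 1"
    using p(2) by (simp add: H2_def p' y' aa bb ba g_def[symmetric] power2_eq_square algebra_simps)
  have qq: "z\<^sup>2 * (g\<^sup>2 - 1) = 1"
    using q(2) by (simp add: H2_def q' z' aa bb ba g_def[symmetric] power2_eq_square algebra_simps)
  have g2: "g\<^sup>2 - 1 > 0" using pp by (metis mult_nonneg_nonpos not_le not_one_le_zero zero_le_power2)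
  have "- (y * (g\<^sup>2 - 1)) \<le> 0" using p(4) by (simp add: p' y' bb ba power2_eq_square algebra_simps)
  then have y: "0 < y" using g2 pp by (auto simp: zero_le_mult_iff less_le)
  have "- (z * (g\<^sup>2 - 1)) \<le> 0" using q(4) by (simp add: q' z' aa g_def[symmetric] power2_eq_square algebra_simps)
  then have z: "0 < z" using g2 qq by (auto simp: zero_le_mult_iff less_le)
  have "y\<^sup>2 = z\<^sup>2" using pp qq g2 by (metis less_irrefl mult_right_cancel)
  then have "y = z" using y z by (simp add: power2_eq_iff_nonneg)
  have "mink p q = (y * z) * (g\<^sup>2 - 1) * g"
    by (simp add: p' q' y' z' aa bb ba g_def[symmetric] power2_eq_square algebra_simps)
  also have "\<dots> = g" using pp \<open>y = z\<close> by (simp add: power2_eq_square)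
  finally have pq: "mink p q = g" .
  have "1 \<le> - g" using H2_mink_le[OF p(2) q(2)] pq by simp
  then have g: "g = - cosh l" using dist pq cosh_arcosh_real[of "- g"] by (simp add: hdist_def)
  then show "mink a b = - cosh l" by (simp add: g_def)
  have "(y * sinh l)\<^sup>2 = 1" using pp by (simp add: g power_mult_distrib sinh_square_eq)
  moreover have "0 < y * sinh l" using y l by simp
  ultimately have "y * sinh l = 1" by (simp add: power2_eq_1_iff)
  then show "sinh l *\<^sub>R p = b + cosh l *\<^sub>R a"
    by (simp add: p' y' g scaleR_add_right mult.commute mult.left_commute algebra_simps)
qed

lemma hexagon_nonneg:
  assumes "\<And>r s. r \<in> T \<Longrightarrow> s \<in> T \<Longrightarrow> r \<noteq> s \<Longrightarrow> 0 \<le> mink n (p r s)" "x \<in> hexagon T p"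
  shows "0 \<le> mink n x"
proof -
  have "convex {y. 0 \<le> mink n y}"
    by (auto simp: convex_def)
  then have "convex hull {p r s |r s. r \<in> T \<and> s \<in> T \<and> r \<noteq> s} \<subseteq> {y. 0 \<le> mink n y}"
    using assms(1) by (intro hull_minimal) auto
  moreover obtain t where "t > 0" "t *\<^sub>R x \<in> convex hull {p r s |r s. r \<in> T \<and> s \<in> T \<and> r \<noteq> s}"
    using assms(2) by (auto simp: hexagon_def)
  ultimately have "0 \<le> t * mink n x" by (metis (mono_tags, lifting) mem_Collect_eq mink_simps(8) subsetD)
  then show ?thesis using \<open>t > 0\<close> by (simp add: zero_le_mult_iff)
qed

lemma hexagon_vertex:
  assumes "r \<in> T" "s \<in> T" "r \<noteq> s" "p r s \<in> H2"
  shows "p r s \<in> hexagon T p"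
proof -
  have "1 *\<^sub>R p r s \<in> convex hull {p r s |r s. r \<in> T \<and> s \<in> T \<and> r \<noteq> s}"
    using assms(1-3) by (intro hull_inc) auto
  with assms(4) show ?thesis unfolding hexagon_def by (metis (mono_tags, lifting) mem_Collect_eq zero_less_one)
qed

lemma realization_face:
  assumes hr: "hexagon_realization T l v p" and rs: "r \<in> T" "s \<in> T" "r \<noteq> s"
    and l: "0 < l r s" "l r s = l s r"
  shows "mink (v r) (v s) = - cosh (l r s)" and "sinh (l r s) *\<^sub>R p r s = v s + cosh (l r s) *\<^sub>R v r"
    and "p r s \<in> edge_line v r s"
proof -
  have e: "p r s \<in> span {v r, v s}" "p r s \<in> H2" "mink (v r) (p r s) = 0"
    "p s r \<in> span {v s, v r}" "p s r \<in> H2" "mink (v s) (p s r) = 0" "hdist (p r s) (p s r) = l r s"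
    using hr rs by (auto simp: hexagon_realization_def edge_line_def perp_def)
  have h: "p r s \<in> hexagon T p" "p s r \<in> hexagon T p"
    using rs e by (auto intro: hexagon_vertex)
  have m: "mink (v r) (v r) = 1" "mink (v s) (v s) = 1" "mink (v s) (p r s) \<le> 0" "mink (v r) (p s r) \<le> 0"
    using hr rs h by (auto simp: hexagon_realization_def)
  have e': "p s r \<in> span {v r, v s}" using e(4) by (simp add: insert_commute)
  show "mink (v r) (v s) = - cosh (l r s)" "sinh (l r s) *\<^sub>R p r s = v s + cosh (l r s) *\<^sub>R v r"
    using realization_gram[OF m(1,2) l(1) e(1-3) m(3) e' e(5,6) m(4) e(7)] by auto
  show "p r s \<in> edge_line v r s" using e by (simp add: edge_line_def)
qed

text \<open>Every normal of the edge plane is a multiple of \<open>n\<close>, and the hexagon point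
  \<open>y\<close> off the edge line rules out negative multiples. So only the sign of the product
  of \<open>n\<close> with \<open>c\<close> matters.\<close>

lemma klein_side_eq_sgn:
  assumes a: "mink (v r) (v r) = 1" "mink (v s) (v s) = 1" "mink (v r) (v s) = - C" "C > 1"
    and n: "mink n (v r) = 0" "mink n (v s) = 0" "mink n n = 1"
    and hex: "\<And>x. x \<in> hexagon T p \<Longrightarrow> 0 \<le> mink n x" and y: "y \<in> hexagon T p" "0 < mink n y"
  shows "klein_side T v p r s c = sgn (mink n c)"
proof -
  have "(\<exists>m\<in>perp (v r) \<inter> perp (v s). (\<forall>x\<in>hexagon T p. mink m x \<ge> 0) \<and> mink m c > 0) \<longleftrightarrow> 0 < mink n c"
  proof
    assume "\<exists>m\<in>perp (v r) \<inter> perp (v s). (\<forall>x\<in>hexagon T p. mink m x \<ge> 0) \<and> mink m c > 0"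
    then obtain m where m: "mink (v r) m = 0" "mink (v s) m = 0" "0 \<le> mink m y" "0 < mink m c"
      using y(1) by (auto simp: perp_def)
    define \<mu> where "\<mu> = mink n m"
    have "m = \<mu> *\<^sub>R n" unfolding \<mu>_def by (rule perp_perp_eq_normal[OF a n m(1,2)])
    then have "0 \<le> \<mu> * mink n y" "0 < \<mu> * mink n c" using m(3,4) by auto
    then show "0 < mink n c" using y(2) by (auto simp: zero_le_mult_iff zero_less_mult_iff)
  next
    assume "0 < mink n c"
    moreover have "n \<in> perp (v r) \<inter> perp (v s)" using n by (simp add: perp_def mink_commute)
    ultimately show "\<exists>m\<in>perp (v r) \<inter> perp (v s). (\<forall>x\<in>hexagon T p. mink m x \<ge> 0) \<and> mink m c > 0"
      using hex by blast
  qed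
  then show ?thesis
    unfolding klein_side_def in_span_iff_normal[OF a n] by (auto simp: sgn_if)
qed

text \<open>The causal type of \<open>c\<close> is the sign of \<open>B\<^sup>2 - A\<^sup>2\<close>.
  The two distance lemmas give the absolute value of the quotient, the Klein side gives its sign,
  and in the light-like case \<open>A = \<bar>B\<bar>\<close>.\<close>

lemma tanh_pow_eq:
  assumes a: "mink (v r) (v r) = 1" "mink (v s) (v s) = 1" "mink (v r) (v s) = - C" "C > 1"
    and n: "mink n (v r) = 0" "mink n (v s) = 0" "mink n n = 1"
    and hex: "\<And>x. x \<in> hexagon T p \<Longrightarrow> 0 \<le> mink n x" and y: "y \<in> hexagon T p" "0 < mink n y"
    and e: "e \<in> edge_line v r s" and c: "c = A *\<^sub>R e + B *\<^sub>R n" "0 < A"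
  shows "tanh_pow T v p r s c = B / A"
proof -
  have L: "x \<in> H2 \<and> mink n x = 0" if "x \<in> edge_line v r s" for x
    using that in_span_iff_normal[OF a n, of x] by (simp add: edge_line_def)
  have ee: "mink e e = -1" "mink n e = 0" "mink e n = 0"
    using L[OF e] by (auto simp: H2_def mink_commute)
  have nc: "mink n c = B" by (simp add: c(1) ee n)
  have cc: "mink c c = B\<^sup>2 - A\<^sup>2" by (simp add: c(1) ee n power2_eq_square)
  have side: "klein_side T v p r s c = sgn B"
    using klein_side_eq_sgn[OF a n hex y] nc by simp
  have tanh: "tanh (sgn B * h) = sgn B * tanh h" for h by (simp add: sgn_if)
  consider "B\<^sup>2 < A\<^sup>2" | "A\<^sup>2 < B\<^sup>2" | "A\<^sup>2 = B\<^sup>2" by linarith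
  then show ?thesis
  proof cases
    case 1
    then show ?thesis
      using tanh_dist_time_like[OF e L n(3) c 1] abs_sgn[of B]
      by (simp add: tanh_pow_def signed_dist_def cc side tanh mult.commute)
  next
    case 2
    then have "B \<noteq> 0" using c(2) by auto
    have "inverse (sgn B * (A / \<bar>B\<bar>)) = B / A" using \<open>B \<noteq> 0\<close> by (auto simp: sgn_if)
    then show ?thesis
      using tanh_dist_space_like[OF e L n(3) c 2] 2
      by (simp add: tanh_pow_def signed_dist_def cc side tanh power_int_minus)
  next
    case 3
    then have "A = \<bar>B\<bar>" using c(2) by (metis abs_of_pos power2_eq_iff_nonneg abs_ge_zero power2_abs less_imp_le)
    then have "sgn B = B / A" using c(2) by (auto simp: sgn_if)
    then show ?thesis using 3 by (simp add: tanh_pow_def cc side)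
  qed
qed

section \<open>The face center relative to the edges of its hexagon\<close>

lemma face_center_decomposition:
  assumes "is_face_center T \<delta> v c" "r \<in> T" "s \<in> T" "r \<noteq> s"
  obtains e A m where "e \<in> edge_line v r s" "c = A *\<^sub>R e + m" "mink (v r) m = 0" "mink (v s) m = 0"
    "mink (v r) c = - A * sinh (\<delta> r s)" "mink (v s) c = - A * sinh (\<delta> s r)"
proof -
  obtain e where e: "is_edge_center v \<delta> r s e" "c \<in> perp_plane v r s e"
    using assms by (auto simp: is_face_center_def)
  obtain A where "c - A *\<^sub>R e \<in> span (perp (v r) \<inter> perp (v s))"
    using e(2) by (auto simp: perp_plane_def span_insert)
  moreover have "subspace (perp (v r) \<inter> perp (v s))"
    by (auto simp: subspace_def perp_def)
  ultimately have m: "c - A *\<^sub>R e \<in> perp (v r) \<inter> perp (v s)" by (metis span_eq_iff)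
  show ?thesis
  proof (rule that[of e A "c - A *\<^sub>R e"])
    show "mink (v r) c = - A * sinh (\<delta> r s)" "mink (v s) c = - A * sinh (\<delta> s r)"
      using m e(1) by (auto simp: perp_def is_edge_center_def)
  qed (use m e(1) in \<open>auto simp: perp_def is_edge_center_def\<close>)
qed

lemma sgn_eq_of_proportional:
  fixes a b x y :: real
  assumes "a * x = b * y" "sgn x = sgn y" "x \<noteq> 0"
  shows "a \<le> 0 \<longleftrightarrow> b \<le> 0"
proof -
  have "sgn a * sgn x = sgn b * sgn y" using assms(1) by (metis sgn_mult)
  moreover have "sgn x \<noteq> 0" using assms(3) by (simp add: sgn_zero_iff)
  ultimately have "sgn a = sgn b" unfolding assms(2) by simp
  then show ?thesis by (metis not_le sgn_1_pos)
qed

text \<open>The coefficient \<open>A\<close> of the edge center in the face center has the same sign for all edges, and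
  \<open>- mink c (p r s)\<close> has that sign, too. It is positive since \<open>- mink c (0, 0, 1) = 1\<close>.\<close>

lemma face_center_coefficient_pos:
  assumes fc: "is_face_center {i, j, k} \<delta> v c" and ne: "i \<noteq> j" "j \<noteq> k" "i \<noteq> k"
    and sgn: "\<And>r s t. r \<in> {i, j, k} \<Longrightarrow> s \<in> {i, j, k} - {r} \<Longrightarrow> t \<in> {i, j, k} - {r} \<Longrightarrow>
      sgn (\<delta> r s) = sgn (\<delta> r t) \<and> \<delta> r s \<noteq> 0"
    and p: "\<And>r s. r \<in> {i, j, k} \<Longrightarrow> s \<in> {i, j, k} \<Longrightarrow> r \<noteq> s \<Longrightarrow> p r s \<in> edge_line v r s"
    and o: "vector [0, 0, 1] \<in> hexagon {i, j, k} p"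
    and A: "mink (v i) c = - A * sinh (\<delta> i j)"
  shows "0 < A"
proof -
  let ?T = "{i, j, k}"
  have "\<exists>A. \<forall>r\<in>?T. \<forall>s\<in>?T - {r}. \<exists>e m. e \<in> edge_line v r s \<and> c = A r s *\<^sub>R e + m \<and>
      mink (v r) m = 0 \<and> mink (v s) m = 0 \<and>
      mink (v r) c = - A r s * sinh (\<delta> r s) \<and> mink (v s) c = - A r s * sinh (\<delta> s r)"
  proof -
    have "\<exists>a. r \<in> ?T \<longrightarrow> s \<in> ?T - {r} \<longrightarrow> (\<exists>e m. e \<in> edge_line v r s \<and> c = a *\<^sub>R e + m \<and>
      mink (v r) m = 0 \<and> mink (v s) m = 0 \<and>
      mink (v r) c = - a * sinh (\<delta> r s) \<and> mink (v s) c = - a * sinh (\<delta> s r))" for r s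
    proof (cases "r \<in> ?T \<and> s \<in> ?T - {r}")
      case True
      then have "r \<in> ?T" "s \<in> ?T" "r \<noteq> s" by auto
      from face_center_decomposition[OF fc this] show ?thesis by metis
    qed blast
    then show ?thesis by metis
  qed
  then obtain a where a: "\<And>r s. r \<in> ?T \<Longrightarrow> s \<in> ?T - {r} \<Longrightarrow>
      \<exists>e m. e \<in> edge_line v r s \<and> c = a r s *\<^sub>R e + m \<and> mink (v r) m = 0 \<and> mink (v s) m = 0 \<and>
      mink (v r) c = - a r s * sinh (\<delta> r s) \<and> mink (v s) c = - a r s * sinh (\<delta> s r)"
    by metis
  \<comment> \<open>Both edges at \<open>r\<close> express the same product of \<open>v r\<close>
    with \<open>c\<close>, and the sines of their parts have equal sign.\<close>
  have rot: "a r s \<le> 0 \<longleftrightarrow> a r t \<le> 0" if "r \<in> ?T" "s \<in> ?T - {r}" "t \<in> ?T - {r}" for r s t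
  proof (rule sgn_eq_of_proportional)
    show "a r s * sinh (\<delta> r s) = a r t * sinh (\<delta> r t)" using a[OF that(1,2)] a[OF that(1,3)] by auto
    show "sgn (sinh (\<delta> r s)) = sgn (sinh (\<delta> r t))" "sinh (\<delta> r s) \<noteq> 0"
      using sgn[OF that] by (auto simp: sgn_if split: if_splits)
  qed
  have flip: "a r s = a s r" if "r \<in> ?T" "s \<in> ?T - {r}" for r s
  proof -
    have "r \<in> ?T - {s}" "s \<in> ?T" using that by auto
    with a[OF that] a[of s r] have "a r s * sinh (\<delta> r s) = a s r * sinh (\<delta> r s)" by auto
    then show ?thesis using sgn[OF that that(2)] by simp
  qed
  have all: "a i j \<le> 0 \<Longrightarrow> a r s \<le> 0" if "r \<in> ?T" "s \<in> ?T" "r \<noteq> s" for r s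
    using that ne rot[of i j k] rot[of j i k] rot[of k i j] flip[of i j] flip[of i k] flip[of j k]
    by auto
  have "a i j * sinh (\<delta> i j) = A * sinh (\<delta> i j)" using a[of i j] A ne by auto
  moreover have "sinh (\<delta> i j) \<noteq> 0" using sgn[of i j j] ne by auto
  ultimately have "A = a i j" by simp
  moreover have "\<not> a i j \<le> 0"
  proof
    assume le: "a i j \<le> 0"
    have "0 \<le> mink c (p r s)" if rs: "r \<in> ?T" "s \<in> ?T" "r \<noteq> s" for r s
    proof -
      from a[of r s] rs obtain e m where e: "e \<in> edge_line v r s" "c = a r s *\<^sub>R e + m"
        "mink (v r) m = 0" "mink (v s) m = 0" by auto
      obtain x y where "p r s = x *\<^sub>R v r + y *\<^sub>R v s"
        using p[OF rs] by (auto simp: edge_line_def in_span_pair)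
      then have "mink m (p r s) = 0" using e(3,4) by (simp add: mink_commute)
      then have "mink c (p r s) = a r s * mink e (p r s)" by (simp add: e(2))
      moreover have "mink e (p r s) \<le> -1"
        using e(1) p[OF rs] by (intro H2_mink_le) (auto simp: edge_line_def)
      ultimately show ?thesis using all[OF rs le] by (simp add: mult_nonpos_nonpos)
    qed
    \<comment> \<open>A nonpositive coefficient would make the product with \<open>c\<close>
      nonnegative on the whole hexagon, but it is -1 at the center of the disk.\<close>
    from hexagon_nonneg[OF this o] have "0 \<le> mink c (vector [0, 0, 1])" .
    moreover have "c $ 3 = 1" using fc by (simp add: is_face_center_def)
    ultimately show False by (simp add: mink_def)
  qed
  ultimately show ?thesis by simp
qed

text \<open>The unit normal \<open>n\<close> of the edge plane is the normalized orthogonal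
  component \<open>w\<close> of \<open>v k\<close>. So \<open>b\<close>, its product with
  \<open>c\<close>, is a combination of the products of \<open>c\<close> with the three
  \<open>v r\<close>, all of which are known from the edge centers of \<open>{i, j}\<close> and
  \<open>{j, k}\<close>.\<close>

lemma tanh_pow_face:
  assumes hr: "hexagon_realization {i, j, k} l v p" and ne: "i \<noteq> j" "j \<noteq> k" "i \<noteq> k"
    and l: "\<And>r s. r \<in> {i, j, k} \<Longrightarrow> s \<in> {i, j, k} \<Longrightarrow> r \<noteq> s \<Longrightarrow> 0 < l r s \<and> l r s = l s r"
    and o: "vector [0, 0, 1] \<in> hexagon {i, j, k} p"
    and fc: "is_face_center {i, j, k} \<delta> v c"
    and sgn: "\<And>r s t. r \<in> {i, j, k} \<Longrightarrow> s \<in> {i, j, k} - {r} \<Longrightarrow> t \<in> {i, j, k} - {r} \<Longrightarrow>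
      sgn (\<delta> r s) = sgn (\<delta> r t) \<and> \<delta> r s \<noteq> 0"
  shows "- 1 / sinh (\<delta> j i) * (tanh_pow {i, j, k} v p i j c / sinh (l i j)) =
      (sinh (\<delta> k j) / sinh (\<delta> j k)
        - (cosh (l i k) + cosh (l i j) * cosh (l j k)) / (sinh (l i j))\<^sup>2 * (sinh (\<delta> i j) / sinh (\<delta> j i))
        - (cosh (l j k) + cosh (l i j) * cosh (l i k)) / (sinh (l i j))\<^sup>2)
            / hex_root (l j k) (l i j) (l i k)"
proof -
  let ?T = "{i, j, k}"
  define c1 c2 c3 s3 R where defs: "c1 = cosh (l j k)" "c2 = cosh (l i k)" "c3 = cosh (l i j)"
    "s3 = sinh (l i j)" "R = hex_root (l j k) (l i j) (l i k)"
  define A B where "A = (c2 + c3 * c1) / s3\<^sup>2" and "B = (c1 + c3 * c2) / s3\<^sup>2"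
  have lpos: "0 < l i j" "0 < l i k" "0 < l j k" "l j i = l i j" "l k i = l i k" "l k j = l j k"
    using l[of i j] l[of i k] l[of j k] ne by auto
  have pos: "0 < s3" "0 < R" "1 < c3" using lpos by (simp_all add: defs hex_root_pos cosh_gt_1)
  have rf: "mink (v r) (v s) = - cosh (l r s)" if "r \<in> ?T" "s \<in> ?T" "r \<noteq> s" for r s
    using realization_face(1)[OF hr that] l[OF that] by blast
  have gram: "mink (v i) (v j) = - c3" "mink (v i) (v k) = - c2" "mink (v j) (v k) = - c1"
    using rf[of i j] rf[of i k] rf[of j k] ne by (simp_all add: defs)
  have gram': "mink (v j) (v i) = - c3" "mink (v k) (v i) = - c2" "mink (v k) (v j) = - c1"
    using gram by (simp_all add: mink_commute)
  have unit: "mink (v i) (v i) = 1" "mink (v j) (v j) = 1" "mink (v k) (v k) = 1"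
    using hr by (auto simp: hexagon_realization_def)
  have s3sq: "s3\<^sup>2 = c3\<^sup>2 - 1" by (simp add: defs sinh_square_eq)
  define w where "w = v k - A *\<^sub>R v i - B *\<^sub>R v j"
  have A': "A * s3\<^sup>2 = c2 + c3 * c1" "B * s3\<^sup>2 = c1 + c3 * c2" using pos by (simp_all add: A_def B_def)
  have "(A - B * c3 + c2) * s3\<^sup>2 = 0" "(B - A * c3 + c1) * s3\<^sup>2 = 0"
    using A' s3sq unfolding left_diff_distrib distrib_right
    by algebra+
  then have AB: "A = B * c3 - c2" "B = A * c3 - c1" using pos by auto
  have wv: "mink w (v i) = 0" "mink w (v j) = 0"
    using AB by (simp_all add: w_def unit gram gram')
  \<comment> \<open>The square of \<open>hex_root\<close> appears here as minus the Gram determinant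
    of the three vectors. As \<open>w\<close> is orthogonal to \<open>v i\<close> and
    \<open>v j\<close>, this is also the square of \<open>w\<close>.\<close>
  have "mink w (v k) * s3\<^sup>2 = s3\<^sup>2 + A * s3\<^sup>2 * c2 + B * s3\<^sup>2 * c1"
    by (simp add: w_def unit gram algebra_simps)
  also have "\<dots> = R\<^sup>2"
    unfolding A' unfolding s3sq defs(5) hex_root_square defs(1-3) by (simp add: power2_eq_square algebra_simps)
  finally have wk: "mink w (v k) = (R / s3)\<^sup>2" using pos by (simp add: power_divide eq_divide_eq)
  have ww: "mink w w = (R / s3)\<^sup>2"
    using wv wk by (simp add: w_def[THEN arg_cong[where f = "mink w"]])
  define n where "n = (s3 / R) *\<^sub>R w"
  have n: "mink n (v i) = 0" "mink n (v j) = 0" "mink n n = 1" "mink n (v k) = R / s3"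
    using pos by (simp_all add: n_def wv ww wk power2_eq_square)
  have np: "sinh (l r s) * mink n (p r s) = mink n (v s) + cosh (l r s) * mink n (v r)"
    if "r \<in> ?T" "s \<in> ?T" "r \<noteq> s" for r s
  proof -
    have "sinh (l r s) *\<^sub>R p r s = v s + cosh (l r s) *\<^sub>R v r"
      using realization_face(2)[OF hr that] l[OF that] by blast
    from arg_cong[where f = "mink n", OF this] show ?thesis by simp
  qed
  \<comment> \<open>Each hexagon vertex is a positive combination of two of the \<open>v r\<close>,
    on which \<open>n\<close> is nonnegative; so \<open>n\<close> points to the side of the hexagon.
    The vertex \<open>p i k\<close> lies strictly on that side.\<close>
  have np0: "0 \<le> mink n (p r s)" if "r \<in> ?T" "s \<in> ?T" "r \<noteq> s" for r s
  proof -
    have "0 \<le> mink n (v q)" if "q \<in> ?T" for q using that n pos by auto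
    then have "0 \<le> sinh (l r s) * mink n (p r s)" unfolding np[OF that] using that by simp
    then show ?thesis using l[OF that] by (simp add: zero_le_mult_iff)
  qed
  have edge: "p r s \<in> edge_line v r s" if "r \<in> ?T" "s \<in> ?T" "r \<noteq> s" for r s
    using realization_face(3)[OF hr that] l[OF that] by blast
  have pik: "p i k \<in> hexagon ?T p"
    using edge[of i k] ne by (intro hexagon_vertex) (auto simp: edge_line_def)
  have npik: "0 < mink n (p i k)"
  proof -
    have "0 < sinh (l i k) * mink n (p i k)" using np[of i k] ne n pos by simp
    then show ?thesis using lpos by (simp add: zero_less_mult_iff)
  qed
  obtain e a m where e: "e \<in> edge_line v i j" "c = a *\<^sub>R e + m" "mink (v i) m = 0" "mink (v j) m = 0"
    "mink (v i) c = - a * sinh (\<delta> i j)" "mink (v j) c = - a * sinh (\<delta> j i)"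
    using face_center_decomposition[OF fc, of i j] ne by auto
  have a: "0 < a"
    by (rule face_center_coefficient_pos[OF fc ne sgn edge o e(5)])
  define b where "b = mink n m"
  have "m = b *\<^sub>R n"
    unfolding b_def by (rule perp_perp_eq_normal[OF unit(1,2) gram(1) pos(3) n(1-3) e(3,4)])
  then have c: "c = a *\<^sub>R e + b *\<^sub>R n" using e(2) by simp
  have T: "tanh_pow ?T v p i j c = b / a"
  proof (rule tanh_pow_eq[where v = v and r = i and s = j,
        OF unit(1,2) gram(1) pos(3) n(1-3) _ pik npik e(1) c a])
    show "0 \<le> mink n x" if "x \<in> hexagon ?T p" for x
      using hexagon_nonneg[OF _ that, of n] np0 by blast
  qed
  \<comment> \<open>The edge \<open>{j, k}\<close> gives the missing product of \<open>v k\<close>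
    with \<open>c\<close>. Comparing the two expressions for the product of \<open>v j\<close> with
    \<open>c\<close> eliminates \<open>a'\<close>.\<close>
  obtain a' where a': "mink (v j) c = - a' * sinh (\<delta> j k)" "mink (v k) c = - a' * sinh (\<delta> k j)"
  proof -
    have "j \<in> ?T" "k \<in> ?T" by auto
    from face_center_decomposition[OF fc this ne(2)] that show thesis by metis
  qed
  have nz: "sinh (\<delta> j i) \<noteq> 0" "sinh (\<delta> j k) \<noteq> 0"
    using sgn[of j i k] sgn[of j k i] ne by auto
  have "a' = a * sinh (\<delta> j i) / sinh (\<delta> j k)" using a'(1) e(6) nz by (simp add: field_simps)
  then have vk: "mink (v k) c = - a * (sinh (\<delta> j i) * (sinh (\<delta> k j) / sinh (\<delta> j k)))"
    using a'(2) by simp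
  have "mink n e = 0"
    using e(1) in_span_iff_normal[OF unit(1,2) gram(1) pos(3) n(1-3)] by (simp add: edge_line_def)
  then have "b = mink n c" by (simp add: e(2) b_def)
  also have "\<dots> = s3 / R * (mink (v k) c - A * mink (v i) c - B * mink (v j) c)"
    by (simp add: n_def w_def)
  also have "\<dots> = s3 / R * (- a) *
      (sinh (\<delta> j i) * (sinh (\<delta> k j) / sinh (\<delta> j k)) - A * sinh (\<delta> i j) - B * sinh (\<delta> j i))"
    unfolding vk e(5,6) by (simp add: algebra_simps)
  also have "\<dots> = s3 / R * (- a) * (sinh (\<delta> j i) *
      (sinh (\<delta> k j) / sinh (\<delta> j k) - A * (sinh (\<delta> i j) / sinh (\<delta> j i)) - B))"
    using nz(1) by (simp add: right_diff_distrib)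
  finally have quotient: "b / a = - (s3 / R * (sinh (\<delta> j i) *
      (sinh (\<delta> k j) / sinh (\<delta> j k) - A * (sinh (\<delta> i j) / sinh (\<delta> j i)) - B)))"
    using a by simp
  have "- 1 / sinh (\<delta> j i) * (tanh_pow ?T v p i j c / s3) =
      (sinh (\<delta> k j) / sinh (\<delta> j k) - A * (sinh (\<delta> i j) / sinh (\<delta> j i)) - B) / R"
  proof -
    have "- 1 / x * (- (s3 / R * (x * y)) / s3) = y / R" if "x \<noteq> 0" for x y
      using that pos by simp
    from this[OF nz(1)] show ?thesis unfolding T quotient .
  qed
  then show ?thesis unfolding A_def B_def defs by simp
qed

section \<open>Assembly of the three statements\<close>

theorem theorem1p11:
  fixes F :: "('b::finite) set set"
    and \<Omega> :: "(real^'b) set"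
    and d :: "real^'b \<Rightarrow> 'b \<Rightarrow> 'b \<Rightarrow> real"
  assumes "closed_surface_triangulation F"
    and "discrete_conformal_structure F \<Omega> d"
    and "normal_form F \<Omega> d"
    and "sign_condition F \<Omega> d"
  shows
    "(\<forall>f\<in>\<Omega>. \<forall>i j k v p c.
        {i, j, k} \<in> F \<longrightarrow>
        hexagon_realization {i, j, k} (edge_length (d f)) v p \<longrightarrow>
        vector [0, 0, 1] \<in> hexagon {i, j, k} p \<longrightarrow>
        is_face_center {i, j, k} (d f) v c \<longrightarrow>
        (\<forall>r\<in>{i, j, k}. span {v r, c} \<inter> perp (v r) \<inter> H2 \<noteq> {}) \<longrightarrow>
        has_partial (\<lambda>g. arc_length (edge_length (d g)) i j k) j
          (- 1 / sinh (d f j i) *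
             (tanh_pow {i, j, k} v p i j c / sinh (edge_length (d f) i j))) f)
     \<and>
     (\<forall>f\<in>\<Omega>. \<forall>i j k. {i, j, k} \<in> F \<longrightarrow>
        (\<exists>Di Dj Dk.
           has_partial (\<lambda>g. arc_length (edge_length (d g)) i j k) i Di f \<and>
           has_partial (\<lambda>g. arc_length (edge_length (d g)) j i k) i Dj f \<and>
           has_partial (\<lambda>g. arc_length (edge_length (d g)) k i j) i Dk f \<and>
           Di = cosh (edge_length (d f) i j) * Dj + cosh (edge_length (d f) i k) * Dk))
     \<and>
     (\<exists>u. change_of_variables \<Omega> u \<and>
        (\<forall>f\<in>\<Omega>. \<forall>i j k. {i, j, k} \<in> F \<longrightarrow>
          (\<exists>D.
             has_partial (\<lambda>w. arc_length (edge_length (d (inv_into \<Omega> (coord_map u) w))) i j k) j D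
               (coord_map u f) \<and>
             has_partial (\<lambda>w. arc_length (edge_length (d (inv_into \<Omega> (coord_map u) w))) j i k) i D
               (coord_map u f))))"
proof (intro conjI ballI allI impI)
  fix f i j k v p c
  assume f: "f \<in> \<Omega>" and ijk: "{i, j, k} \<in> F"
    and hr: "hexagon_realization {i, j, k} (edge_length (d f)) v p"
    and o: "vector [0, 0, 1] \<in> hexagon {i, j, k} p"
    and fc: "is_face_center {i, j, k} (d f) v c"
  note ne = face_distinct[OF assms(1) ijk]
  have l: "0 < edge_length (d f) r s \<and> edge_length (d f) r s = edge_length (d f) s r"
    if "r \<in> {i, j, k}" "s \<in> {i, j, k}" "r \<noteq> s" for r s
    using assms(2) f oriented_edgesI[OF ijk that] edge_length_commute[of "d f" r s]
    unfolding discrete_conformal_structure_def by blast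
  have sgn: "sgn (d f r s) = sgn (d f r t) \<and> d f r s \<noteq> 0"
    if "r \<in> {i, j, k}" "s \<in> {i, j, k} - {r}" "t \<in> {i, j, k} - {r}" for r s t
    using sign_condition_face[OF assms(4) f ijk, of r s t] that by auto
  have "d f j i \<noteq> 0" "d f j k \<noteq> 0" using sgn[of j i k] sgn[of j k i] ne by auto
  \<comment> \<open>The cosine law and the face center computation end in the same expression, so
    rewriting with the latter closes the gap.\<close>
  from has_partial_arc_length_other_sinh[OF assms(2) f ijk _ _ _ ne this]
  show "has_partial (\<lambda>g. arc_length (edge_length (d g)) i j k) j
          (- 1 / sinh (d f j i) *
             (tanh_pow {i, j, k} v p i j c / sinh (edge_length (d f) i j))) f"
    by (subst tanh_pow_face[OF hr ne _ o fc]) (use l sgn in blast)+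
next
  fix f i j k assume f: "f \<in> \<Omega>" and ijk: "{i, j, k} \<in> F"
  show "\<exists>Di Dj Dk.
           has_partial (\<lambda>g. arc_length (edge_length (d g)) i j k) i Di f \<and>
           has_partial (\<lambda>g. arc_length (edge_length (d g)) j i k) i Dj f \<and>
           has_partial (\<lambda>g. arc_length (edge_length (d g)) k i j) i Dk f \<and>
           Di = cosh (edge_length (d f) i j) * Dj + cosh (edge_length (d f) i k) * Dk"
    by (rule arc_derivative_relation[OF assms(2) f ijk _ _ _ face_distinct[OF assms(1) ijk]]) auto
next
  show "\<exists>u. change_of_variables \<Omega> u \<and>
        (\<forall>f\<in>\<Omega>. \<forall>i j k. {i, j, k} \<in> F \<longrightarrow>
          (\<exists>D.
             has_partial (\<lambda>w. arc_length (edge_length (d (inv_into \<Omega> (coord_map u) w))) i j k) j D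
               (coord_map u f) \<and>
             has_partial (\<lambda>w. arc_length (edge_length (d (inv_into \<Omega> (coord_map u) w))) j i k) i D
               (coord_map u f)))"
    by (rule symmetric_change_of_variables[OF assms])
qed

end
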